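(* Fix integers $k\ge 3$ and $1\le i\le k-1$, and let $m$ be a positive integer and $n\ge 0$ an integer. (1) The number of $(k,i)$-singular overpartitions of $n$ with exactly $m$ dotted blocks and whose last dotted block is negative equals $p\left(n-k\binom{m}{2}-im\right)$. (2) The number of $(k,i)$-singular overpartitions of $n$ with exactly $m$ dotted blocks and whose last dotted block is positive equals $p\left(n-k\binom{m+1}{2}+im\right)$.
   Context: $p(N)$ denotes the number of ordinary partitions of $N$, with $p(0)=1$ and $p(N)=0$ for $N<0$. A Frobenius symbol for $n$ is a two-rowed array $\begin{pmatrix} a_1 & \cdots & a_\delta\\ b_1&\cdots&b_\delta\end{pmatrix}$ ($\delta\ge0$) of integers with $a_1>\cdots>a_\delta\ge 0$, $b_1>\cdots>b_\delta\ge0$ and $\sum_{t=1}^\delta(a_t+b_t+1)=n$. A column $(a_t;b_t)$ is $(k,i)$-positive if $a_t-b_t\ge k-i-1$, $(k,i)$-negative if $a_t-b_t\le 1-i$, and $(k,i)$-neutral otherwise. The columns are divided into $(k,i)$-parity blocks: sets of contiguous columns, maximally extended to the right, in which all non-neutral columns have the same parity. Concretely, the first block starts at the first column, and a new block starts at each non-neutral column whose parity is opposite to that of the nearest non-neutral column to its left. A block is called positive (resp. negative) if its non-neutral columns are positive (resp. negative). If all columns are neutral, there is a single neutral block. The anchor of a non-neutral block is its first non-neutral column. Number the non-neutral blocks $B_1,B_2,\dots$ from left to right; their parities alternate. A $(k,i)$-singular overpartition of $n$ is a Frobenius symbol for $n$ in which some entries may be overlined, subject to exactly one of the following: (a) there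 are no overlined entries; (b) there is exactly one overlined entry, it lies in the top row, and it is in the anchor of a positive block; (c) there is exactly one overlined entry, it lies in the bottom row, and it is in the anchor of a negative block; (d) there are exactly two overlined entries, lying in the anchors of two consecutive non-neutral blocks: one in the top row of the anchor of the positive block and the other in the bottom row of the anchor of the negative block. Dotted blocks are determined as follows. In case (a) no block is dotted. In cases (b) and (c), if the overlined entry lies in $B_j$, the dotted blocks are $B_1,\dots,B_j$. In case (d), if the overlined entries lie in $B_j$ and $B_{j+1}$, the dotted blocks are $B_2,\dots,B_{j+1}$. The last dotted block is the rightmost dotted block. *)

theory Defs
  imports Main "HOL-Library.Multiset"
begin

definition partition_count :: "int \<Rightarrow> nat" where
  "partition_count N = card {M :: nat multiset. 0 \<notin># M \<and> int (\<Sum>\<^sub># M) = N}"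

text \<open>A symbol is the list of its columns \<open>(a, b)\<close>, indexed from 0.\<close>

type_synonym symbol = "(nat \<times> nat) list"

definition frobenius_symbol :: "nat \<Rightarrow> symbol \<Rightarrow> bool" where
  "frobenius_symbol n xs \<longleftrightarrow>
     sorted_wrt (>) (map fst xs) \<and> sorted_wrt (>) (map snd xs) \<and>
     (\<Sum>(a, b) \<leftarrow> xs. a + b + 1) = n"

datatype parity = Positive | Negative | Neutral

text \<open>The first two conditions exclude each other as soon as \<open>k \<ge> 3\<close>.\<close>

definition column_parity :: "int \<Rightarrow> int \<Rightarrow> nat \<times> nat \<Rightarrow> parity" where
  "column_parity k i c =
     (if int (fst c) - int (snd c) \<ge> k - i - 1 then Positive
      else if int (fst c) - int (snd c) \<le> 1 - i then Negative
      else Neutral)"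

definition block_start :: "int \<Rightarrow> int \<Rightarrow> symbol \<Rightarrow> nat \<Rightarrow> bool" where
  "block_start k i xs t \<longleftrightarrow> t < length xs \<and>
     (t = 0 \<or>
      column_parity k i (xs ! t) \<noteq> Neutral \<and>
      (\<exists>s<t. column_parity k i (xs ! s) \<noteq> Neutral \<and>
             (\<forall>r. s < r \<and> r < t \<longrightarrow> column_parity k i (xs ! r) = Neutral) \<and>
             column_parity k i (xs ! s) \<noteq> column_parity k i (xs ! t)))"

text \<open>A block is the set of the indices of its columns.\<close>

definition block_from :: "int \<Rightarrow> int \<Rightarrow> symbol \<Rightarrow> nat \<Rightarrow> nat set" where
  "block_from k i xs s =
     {t. s \<le> t \<and> t < length xs \<and> (\<forall>r. s < r \<and> r \<le> t \<longrightarrow> \<not> block_start k i xs r)}"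

definition parity_blocks :: "int \<Rightarrow> int \<Rightarrow> symbol \<Rightarrow> nat set list" where
  "parity_blocks k i xs =
     map (block_from k i xs) (filter (block_start k i xs) [0..<length xs])"

definition non_neutral_columns :: "int \<Rightarrow> int \<Rightarrow> symbol \<Rightarrow> nat set \<Rightarrow> nat set" where
  "non_neutral_columns k i xs B = {t \<in> B. column_parity k i (xs ! t) \<noteq> Neutral}"

definition positive_block :: "int \<Rightarrow> int \<Rightarrow> symbol \<Rightarrow> nat set \<Rightarrow> bool" where
  "positive_block k i xs B \<longleftrightarrow> non_neutral_columns k i xs B \<noteq> {} \<and>
     (\<forall>t \<in> non_neutral_columns k i xs B. column_parity k i (xs ! t) = Positive)"

definition negative_block :: "int \<Rightarrow> int \<Rightarrow> symbol \<Rightarrow> nat set \<Rightarrow> bool" where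
  "negative_block k i xs B \<longleftrightarrow> non_neutral_columns k i xs B \<noteq> {} \<and>
     (\<forall>t \<in> non_neutral_columns k i xs B. column_parity k i (xs ! t) = Negative)"

definition anchor :: "int \<Rightarrow> int \<Rightarrow> symbol \<Rightarrow> nat set \<Rightarrow> nat" where
  "anchor k i xs B = Min (non_neutral_columns k i xs B)"

text \<open>The list \<open>B\<^sub>1, B\<^sub>2, \<dots>\<close>; the block \<open>B\<^sub>j\<close> has list index \<open>j - 1\<close>.\<close>

definition non_neutral_blocks :: "int \<Rightarrow> int \<Rightarrow> symbol \<Rightarrow> nat set list" where
  "non_neutral_blocks k i xs =
     filter (\<lambda>B. non_neutral_columns k i xs B \<noteq> {}) (parity_blocks k i xs)"

text \<open>
  A symbol with overlined entries is a triple \<open>(xs, T, U)\<close>, where \<open>T\<close> and \<open>U\<close> are the sets of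
  the indices of the columns whose top, respectively bottom, entry is overlined.
\<close>

type_synonym overlined_symbol = "symbol \<times> nat set \<times> nat set"

definition singular_overpartition :: "int \<Rightarrow> int \<Rightarrow> nat \<Rightarrow> overlined_symbol \<Rightarrow> bool" where
  "singular_overpartition k i n = (\<lambda>(xs, T, U).
     let Bs = non_neutral_blocks k i xs in
       frobenius_symbol n xs \<and>
       (T = {} \<and> U = {} \<or>
        (\<exists>j < length Bs. positive_block k i xs (Bs ! j) \<and>
           T = {anchor k i xs (Bs ! j)} \<and> U = {}) \<or>
        (\<exists>j < length Bs. negative_block k i xs (Bs ! j) \<and>
           T = {} \<and> U = {anchor k i xs (Bs ! j)}) \<or>
        (\<exists>j. Suc j < length Bs \<and>
           (positive_block k i xs (Bs ! j) \<and> negative_block k i xs (Bs ! Suc j) \<and>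
              T = {anchor k i xs (Bs ! j)} \<and> U = {anchor k i xs (Bs ! Suc j)} \<or>
            negative_block k i xs (Bs ! j) \<and> positive_block k i xs (Bs ! Suc j) \<and>
              T = {anchor k i xs (Bs ! Suc j)} \<and> U = {anchor k i xs (Bs ! j)}))))"

text \<open>
  The set of the list indices of the dotted blocks. With \<open>J\<close> the indices of the blocks containing
  overlined entries: one overlined entry dots \<open>B\<^sub>1\<close> up to its block; two overlined entries dot
  \<open>B\<^sub>2\<close> up to the right one of their two blocks.
\<close>

definition dotted_blocks :: "int \<Rightarrow> int \<Rightarrow> overlined_symbol \<Rightarrow> nat set" where
  "dotted_blocks k i = (\<lambda>(xs, T, U).
     let Bs = non_neutral_blocks k i xs;
         J = {j. j < length Bs \<and> (T \<union> U) \<inter> Bs ! j \<noteq> {}}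
     in if card T + card U = 0 then {}
        else if card T + card U = 1 then {0..Max J}
        else {1..Max J})"

definition last_dotted_block :: "int \<Rightarrow> int \<Rightarrow> overlined_symbol \<Rightarrow> nat set" where
  "last_dotted_block k i \<omega> = non_neutral_blocks k i (fst \<omega>) ! Max (dotted_blocks k i \<omega>)"

end

theory Submission
  imports Defs
begin

text \<open>
  A symbol has at most one admissible overlining with \<open>m\<close> dotted blocks and a prescribed parity of
  the last dotted block, and it has one exactly if its sequence of column parities contains an
  alternating subsequence of length \<open>m\<close> ending in that parity: take the anchors of the dotted blocks.

  To count the symbols with such a subsequence ending in a negative column, consider pairs of strictly
  decreasing rows whose lengths differ by a charge \<open>c\<close>. At the last negative column \<open>t\<close>, exchange the
  first \<open>t - 1\<close> top entries with the first \<open>t\<close> bottom entries, shifted by \<open>i - 2\<close>. This is a reflection: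
  it flips the parities to the left of \<open>t\<close> with respect to \<open>i + k - 4\<close>, leaves no negative column to
  the right, raises the charge by 2 and lowers the weight by \<open>i - 1\<close>. After \<open>m\<close> exchanges no condition
  is left but the charge \<open>2 m\<close>, and pairs of charge \<open>c\<close> are counted by partitions with weight offset
  \<open>c choose 2\<close>. Exchanging the two rows and replacing \<open>i\<close> by \<open>k - i\<close> gives the positive case.
\<close>

section \<open>Pairs of rows of a given charge\<close>

text \<open>In a Maya diagram the top entries a are particles at the positions a, and the bottom
  entries b are holes at the positions -1 - b. The charge \<open>c\<close> is the surplus of
  particles. A bottom entry contributes b + 1 to the weight, so at charge 0 this is the weight of a
  Frobenius symbol.\<close>

definition charged_pairs :: "nat \<Rightarrow> int \<Rightarrow> (int list \<times> int list) set" where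
  "charged_pairs c E = {(as, bs). sorted_wrt (>) as \<and> sorted_wrt (>) bs \<and>
     (\<forall>x \<in> set as \<union> set bs. 0 \<le> x) \<and> length as = length bs + c \<and>
     sum_list as + sum_list bs + int (length bs) = E}"

lemma strict_decreasing_zero_cases:
  fixes xs :: "int list"
  assumes "sorted_wrt (>) xs" "\<forall>x\<in>set xs. 0 \<le> x"
  obtains (zero) ys where "xs = ys @ [0]" "\<forall>x\<in>set ys. 0 < x" "sorted_wrt (>) ys"
  | (pos) "\<forall>x\<in>set xs. 0 < x" "0 \<notin> set xs"
proof (cases "0 \<in> set xs")
  case True
  then obtain ys zs where xs: "xs = ys @ 0 # zs"
    by (meson split_list)
  have "zs = []"
    using assms unfolding xs by (cases zs) (auto simp: sorted_wrt_append)
  then show ?thesis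
    using assms xs by (intro zero[of ys]) (auto simp: sorted_wrt_append)
next
  case False
  then show ?thesis
    using assms(2) by (intro pos) (metis order_le_less, simp)
qed

lemma sorted_wrt_map_add:
  "sorted_wrt (>) (map (\<lambda>x. x + d) xs) \<longleftrightarrow> sorted_wrt (>) xs" for d :: int
  by (simp add: sorted_wrt_map)

lemma sorted_wrt_map_diff:
  "sorted_wrt (>) (map (\<lambda>x. x - d) xs) \<longleftrightarrow> sorted_wrt (>) xs" for d :: int
  by (simp add: sorted_wrt_map)

lemma sum_list_map_add:
  "sum_list (map (\<lambda>x. x + d) xs) = sum_list xs + d * int (length xs)" for d :: int
  by (induction xs) (auto simp: algebra_simps)

lemma sum_list_map_diff:
  "sum_list (map (\<lambda>x. x - d) xs) = sum_list xs - d * int (length xs)" for d :: int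
  by (induction xs) (auto simp: algebra_simps)

text \<open>The shift of the whole Maya diagram by one position. A hole at -1 (bottom entry 0) moves
  to position 0 and leaves the bottom row; if there is none, the particle at -1 becomes a new top
  entry 0. In a strictly decreasing row an entry 0 is the last one, hence
  \<open>butlast\<close>.\<close>

definition raise_charge :: "int list \<times> int list \<Rightarrow> int list \<times> int list" where
  "raise_charge = (\<lambda>(as, bs).
     if 0 \<in> set bs then (map (\<lambda>x. x + 1) as, map (\<lambda>x. x - 1) (butlast bs))
     else (map (\<lambda>x. x + 1) as @ [0], map (\<lambda>x. x - 1) bs))"

definition lower_charge :: "int list \<times> int list \<Rightarrow> int list \<times> int list" where
  "lower_charge = (\<lambda>(as, bs).
     if 0 \<in> set as then (map (\<lambda>x. x - 1) (butlast as), map (\<lambda>x. x + 1) bs)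
     else (map (\<lambda>x. x - 1) as, map (\<lambda>x. x + 1) bs @ [0]))"

text \<open>Each top entry gains 1, and the bottom row loses \<open>length bs\<close> in weight in
  both cases, since a removed entry 0 had weight 1. The net gain is the charge
  \<open>c\<close>.\<close>

lemma raise_charge_charged_pairs:
  assumes "p \<in> charged_pairs c E"
  shows "raise_charge p \<in> charged_pairs (Suc c) (E + int c) \<and> lower_charge (raise_charge p) = p"
proof -
  obtain as bs where p: "p = (as, bs)" by force
  have as: "sorted_wrt (>) as" "\<forall>x\<in>set as. 0 \<le> x" and bs: "sorted_wrt (>) bs" "\<forall>x\<in>set bs. 0 \<le> x"
    using assms by (auto simp: p charged_pairs_def)
  from bs show ?thesis
  proof (cases rule: strict_decreasing_zero_cases)
    case (zero ys)
    \<comment> \<open>No top entry 0 arises, so \<open>lower_charge\<close> takes its second branch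
      and restores the removed bottom entry 0.\<close>
    have "0 \<notin> (\<lambda>x. x + 1) ` set as" using as by force
    then show ?thesis
      using assms as zero
      by (auto simp: p charged_pairs_def raise_charge_def lower_charge_def sorted_wrt_map_add
          sorted_wrt_map_diff sum_list_map_add sum_list_map_diff sorted_wrt_append comp_def)
  next
    case pos
    then show ?thesis
      using assms as bs
      by (auto simp: p charged_pairs_def raise_charge_def lower_charge_def sorted_wrt_map_add
          sorted_wrt_map_diff sum_list_map_add sum_list_map_diff sorted_wrt_append comp_def)
  qed
qed

lemma lower_charge_charged_pairs:
  assumes "p \<in> charged_pairs (Suc c) (E + int c)"
  shows "lower_charge p \<in> charged_pairs c E \<and> raise_charge (lower_charge p) = p"
proof -
  obtain as bs where p: "p = (as, bs)" by force
  have bs: "sorted_wrt (>) bs" "\<forall>x\<in>set bs. 0 \<le> x" and as: "sorted_wrt (>) as" "\<forall>x\<in>set as. 0 \<le> x"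
    using assms by (auto simp: p charged_pairs_def)
  from as show ?thesis
  proof (cases rule: strict_decreasing_zero_cases)
    case (zero ys)
    have "0 \<notin> (\<lambda>x. x + 1) ` set bs" using bs by force
    then show ?thesis
      using assms bs zero
      by (auto simp: p charged_pairs_def raise_charge_def lower_charge_def sorted_wrt_map_add
          sorted_wrt_map_diff sum_list_map_add sum_list_map_diff sorted_wrt_append comp_def)
  next
    case pos
    then show ?thesis
      using assms as bs
      by (auto simp: p charged_pairs_def raise_charge_def lower_charge_def sorted_wrt_map_add
          sorted_wrt_map_diff sum_list_map_add sum_list_map_diff sorted_wrt_append comp_def algebra_simps)
  qed
qed

lemma card_charged_pairs_Suc:
  "card (charged_pairs (Suc c) (E + int c)) = card (charged_pairs c E)"
proof -
  have "bij_betw raise_charge (charged_pairs c E) (charged_pairs (Suc c) (E + int c))"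
    by (rule bij_betw_byWitness[where f' = lower_charge])
      (use raise_charge_charged_pairs lower_charge_charged_pairs in blast)+
  then show ?thesis
    by (simp add: bij_betw_same_card)
qed

text \<open>The offset \<open>c choose 2\<close> is the sum 0 + ... + (c - 1) of the weights gained
  while the charge is raised from 0 to \<open>c\<close>.\<close>

lemma card_charged_pairs_add:
  "card (charged_pairs (c + r) (N + int ((c + r) choose 2))) =
   card (charged_pairs c (N + int (c choose 2)))"
proof (induction r)
  case (Suc r)
  have "N + int ((c + Suc r) choose 2) = N + int ((c + r) choose 2) + int (c + r)"
    by (simp add: numeral_2_eq_2)
  then show ?case
    using Suc card_charged_pairs_Suc[of "c + r" "N + int ((c + r) choose 2)"]
    by (simp add: add.assoc)
qed simp

section \<open>Large charge: single rows and partitions\<close>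

lemma strict_decreasing_nth_ge:
  fixes xs :: "int list"
  assumes "sorted_wrt (>) xs" "\<forall>x\<in>set xs. 0 \<le> x" "s < length xs"
  shows "int (length xs) - 1 - int s \<le> xs ! s"
  using assms
proof (induction xs arbitrary: s)
  case (Cons x xs)
  show ?case
  proof (cases s)
    case 0
    show ?thesis
    proof (cases xs)
      case (Cons y ys)
      then have "x > y" using Cons.prems by simp
      moreover have "int (length xs) - 1 \<le> y"
        using Cons.IH[of 0] Cons.prems Cons by simp
      ultimately show ?thesis using 0 by simp
    qed (use Cons.prems 0 in auto)
  next
    case (Suc s')
    then show ?thesis
      using Cons.IH[of s'] Cons.prems by simp
  qed
qed simp

lemma strict_decreasing_sum_ge:
  fixes xs :: "int list"
  assumes "sorted_wrt (>) xs" "\<forall>x\<in>set xs. 0 \<le> x"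
  shows "int (length xs choose 2) \<le> sum_list xs"
  using assms
proof (induction xs)
  case (Cons x xs)
  have "int (length xs) \<le> x"
    using strict_decreasing_nth_ge[of "x # xs" 0] Cons.prems by simp
  then show ?case
    using Cons by (simp add: numeral_2_eq_2)
qed simp

text \<open>A nonempty bottom row would force at least c + 1 distinct nonnegative top entries, of
  sum at least (c choose 2) + c. Together with the positive weight of the bottom row this exceeds
  the given weight, as N \<le> c.\<close>

lemma charged_pairs_large_charge:
  assumes "N \<le> int c"
  shows "charged_pairs c (N + int (c choose 2)) =
    (\<lambda>as. (as, [])) ` {as. sorted_wrt (>) as \<and> (\<forall>x\<in>set as. 0 \<le> x) \<and> length as = c \<and>
       sum_list as = N + int (c choose 2)}"
proof -
  have empty: "bs = []" if "(as, bs) \<in> charged_pairs c (N + int (c choose 2))" for as bs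
  proof (rule ccontr)
    assume "bs \<noteq> []"
    then have len: "Suc c \<le> length as" "int (length bs) > 0"
      using that by (cases bs; auto simp: charged_pairs_def)+
    have "int (Suc c choose 2) \<le> int (length as choose 2)"
      using len(1) by (simp add: binomial_right_mono)
    also have "\<dots> \<le> sum_list as"
      using that by (intro strict_decreasing_sum_ge) (auto simp: charged_pairs_def)
    finally have "int (Suc c choose 2) \<le> sum_list as" .
    moreover have "0 \<le> sum_list bs"
      using that by (intro sum_list_nonneg) (auto simp: charged_pairs_def)
    ultimately show False
      using that len(2) assms by (simp add: charged_pairs_def numeral_2_eq_2)
  qed
  show ?thesis
  proof (intro equalityI subsetI)
    fix p assume p: "p \<in> charged_pairs c (N + int (c choose 2))"
    then obtain as where "p = (as, [])"
      using empty by (metis surj_pair)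
    then show "p \<in> (\<lambda>as. (as, [])) ` {as. sorted_wrt (>) as \<and> (\<forall>x\<in>set as. 0 \<le> x) \<and>
        length as = c \<and> sum_list as = N + int (c choose 2)}"
      using p by (simp add: charged_pairs_def)
  qed (auto simp: charged_pairs_def)
qed


text \<open>All parts are positive, so a partition of N has at most N \<le> c parts, and zeros pad
  it to length \<open>c\<close>.\<close>

lemma partition_count_sorted_lists:
  assumes "N \<le> int c"
  shows "partition_count N = card {ys :: nat list. sorted ys \<and> length ys = c \<and> int (sum_list ys) = N}"
proof -
  let ?f = "\<lambda>M. replicate (c - size M) 0 @ sorted_list_of_multiset (M :: nat multiset)"
  let ?g = "\<lambda>ys. filter_mset (\<lambda>x. x \<noteq> 0) (mset (ys :: nat list))"
  have size_le: "size M \<le> \<Sum>\<^sub># M" if "0 \<notin># M" for M :: "nat multiset"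
    using that by (induction M) auto
  have filter_zero: "filter_mset (\<lambda>x. x \<noteq> 0) M = M" if "0 \<notin># M" for M :: "nat multiset"
    using that by (metis (mono_tags, lifting) filter_mset_True filter_mset_cong)
  have split: "replicate_mset (count M 0) 0 + filter_mset (\<lambda>x. x \<noteq> 0) M = M" for M :: "nat multiset"
    by (metis filter_eq_replicate_mset multiset_partition)
  have split_size: "count M 0 + size (filter_mset (\<lambda>x. x \<noteq> 0) M) = size M" for M :: "nat multiset"
    using arg_cong[OF split[of M], of size] by simp
  have split_sum: "\<Sum>\<^sub># (filter_mset (\<lambda>x. x \<noteq> 0) M) = \<Sum>\<^sub># M" for M :: "nat multiset"
    using arg_cong[OF split[of M], of sum_mset] by simp
  have sorted_f: "sorted (?f M)" for M
    by (auto simp: sorted_append)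
  have fg: "?f (?g ys) = ys" if "sorted ys" "length ys = c" for ys
  proof -
    have "c - size (?g ys) = count (mset ys) 0"
      using split_size[of "mset ys"] that(2) by simp
    then have "mset (?f (?g ys)) = mset ys"
      using split[of "mset ys"] by simp
    then show ?thesis
      using that(1) sorted_f by (metis properties_for_sort)
  qed
  have "bij_betw ?f {M. 0 \<notin># M \<and> int (\<Sum>\<^sub># M) = N}
      {ys. sorted ys \<and> length ys = c \<and> int (sum_list ys) = N}"
  proof (rule bij_betw_byWitness[where f' = ?g])
    show "\<forall>M\<in>{M. 0 \<notin># M \<and> int (\<Sum>\<^sub># M) = N}. ?g (?f M) = M"
      using filter_zero by simp
    show "\<forall>ys\<in>{ys. sorted ys \<and> length ys = c \<and> int (sum_list ys) = N}. ?f (?g ys) = ys"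
      using fg by blast
    show "?f ` {M. 0 \<notin># M \<and> int (\<Sum>\<^sub># M) = N} \<subseteq> {ys. sorted ys \<and> length ys = c \<and> int (sum_list ys) = N}"
    proof (clarify, intro conjI)
      fix M :: "nat multiset" assume M: "0 \<notin># M" "N = int (\<Sum>\<^sub># M)"
      show "sorted (?f M)" by (rule sorted_f)
      have "int (size M) \<le> int (\<Sum>\<^sub># M)"
        using size_le[OF M(1)] by (simp only: of_nat_le_iff)
      then have "size M \<le> c"
        using assms unfolding M(2) by linarith
      moreover have "length (sorted_list_of_multiset M) = size M"
        by (metis mset_sorted_list_of_multiset size_mset)
      ultimately show "length (?f M) = c"
        by simp
      have "sum_list (sorted_list_of_multiset M) = \<Sum>\<^sub># M"
        by (metis mset_sorted_list_of_multiset sum_mset_sum_list)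
      then show "int (sum_list (?f M)) = int (\<Sum>\<^sub># M)"
        by (simp add: sum_list_replicate)
    qed
    show "?g ` {ys. sorted ys \<and> length ys = c \<and> int (sum_list ys) = N} \<subseteq> {M. 0 \<notin># M \<and> int (\<Sum>\<^sub># M) = N}"
      by (auto simp: split_sum[unfolded neq0_conv] sum_mset_sum_list simp del: of_nat_sum_mset)
  qed
  then show ?thesis
    unfolding partition_count_def by (rule bij_betw_same_card)
qed

lemma sum_index_eq_choose_two:
  "(\<Sum>j<c. int j) = int (c choose 2)"
  by (induction c) (auto simp: numeral_2_eq_2)

text \<open>Removal of a staircase: the j-th smallest entry, counted from 0, is at least j, and
  subtracting j from it leaves a weakly increasing list. The staircase has sum
  \<open>c choose 2\<close>.\<close>

lemma card_strict_decreasing_lists: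
  "card {as. sorted_wrt (>) as \<and> (\<forall>x\<in>set as. 0 \<le> x) \<and> length as = c \<and>
       sum_list as = N + int (c choose 2)} =
   card {ys :: nat list. sorted ys \<and> length ys = c \<and> int (sum_list ys) = N}"
   (is "card ?S = card ?T")
proof -
  let ?f = "\<lambda>ys. rev (map (\<lambda>j. int (ys ! j + j)) [0..<c])"
  let ?g = "\<lambda>as. map (\<lambda>j. nat (rev as ! j - int j)) [0..<c]"
  have ge: "int j \<le> rev as ! j" if "as \<in> ?S" "j < c" for as j
    using strict_decreasing_nth_ge[of as "c - Suc j"] that by (auto simp: rev_nth)
  have fg: "?f (?g as) = as" if "as \<in> ?S" for as
  proof -
    have "map (\<lambda>j. int (?g as ! j + j)) [0..<c] = rev as"
      using ge[OF that] that by (intro nth_equalityI) auto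
    then show ?thesis by simp
  qed
  have sum_f: "sum_list (?f ys) = int (sum_list ys) + int (c choose 2)" if "length ys = c" for ys
  proof -
    have "sum_list (?f ys) = (\<Sum>j<c. int (ys ! j) + int j)"
      by (simp add: sum_list_rev interv_sum_list_conv_sum_set_nat atLeast0LessThan flip: rev_map)
    also have "\<dots> = int (sum_list ys) + int (c choose 2)"
      using that by (simp add: sum.distrib sum_index_eq_choose_two sum_list_sum_nth atLeast0LessThan)
    finally show ?thesis .
  qed
  have "bij_betw ?f ?T ?S"
  proof (rule bij_betw_byWitness[where f' = ?g])
    show "\<forall>ys\<in>?T. ?g (?f ys) = ys"
      by (auto intro!: nth_equalityI)
    show "\<forall>as\<in>?S. ?f (?g as) = as"
      using fg by blast
    show "?f ` ?T \<subseteq> ?S"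
    proof (rule image_subsetI)
      fix ys :: "nat list" assume ys: "ys \<in> ?T"
      have "ys ! j + j < ys ! l + l" if "j < l" "l < c" for j l
        using ys that by (intro add_le_less_mono) (auto simp: sorted_iff_nth_mono)
      then have "sorted_wrt (<) (map (\<lambda>j. int (ys ! j + j)) [0..<c])"
        unfolding sorted_wrt_iff_nth_less by (simp flip: of_nat_add)
      then have "sorted_wrt (>) (?f ys)"
        by (simp only: sorted_wrt_rev)
      then show "?f ys \<in> ?S"
        using ys sum_f[of ys] by simp
    qed
    show "?g ` ?S \<subseteq> ?T"
    proof (rule image_subsetI)
      fix as assume as: "as \<in> ?S"
      have "rev as ! j < rev as ! Suc j" if "Suc j < c" for j
        using as that by (auto simp: rev_nth sorted_wrt_iff_nth_less)
      then have "sorted (?g as)"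
        unfolding sorted_iff_nth_Suc by (force intro!: nat_mono)
      moreover have "int (sum_list (?g as)) = N"
        using sum_f[of "?g as"] unfolding fg[OF as] using as by simp
      ultimately show "?g as \<in> ?T" by simp
    qed
  qed
  then show ?thesis
    by (simp add: bij_betw_same_card)
qed

lemma card_charged_pairs:
  "card (charged_pairs c (N + int (c choose 2))) = partition_count N"
proof -
  \<comment> \<open>A charge that is at least N, so that the bottom row is empty; for negative N,
    \<open>nat N\<close> is 0 and \<open>c\<close> itself suffices.\<close>
  define d where "d = c + nat N"
  have "card (charged_pairs c (N + int (c choose 2))) = card (charged_pairs d (N + int (d choose 2)))"
    unfolding d_def by (rule card_charged_pairs_add[symmetric])
  also have "N \<le> int d" by (simp add: d_def)
  then have "card (charged_pairs d (N + int (d choose 2))) = partition_count N"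
    by (simp add: charged_pairs_large_charge card_image inj_on_def card_strict_decreasing_lists
        partition_count_sorted_lists)
  finally show ?thesis .
qed

section \<open>Alternating subsequences and the exchange bijection\<close>

fun opposite :: "parity \<Rightarrow> parity" where
  "opposite Positive = Negative"
| "opposite Negative = Positive"
| "opposite Neutral = Neutral"

lemma opposite_opposite [simp]: "opposite (opposite p) = p"
  by (cases p) auto

lemma opposite_eq_iff [simp]: "opposite p = opposite q \<longleftrightarrow> p = q"
  by (cases p; cases q) auto

text \<open>Some subsequence of length \<open>m\<close> alternates between \<open>p\<close> and its opposite and ends in \<open>p\<close>.\<close>

fun alternates :: "nat \<Rightarrow> parity \<Rightarrow> parity list \<Rightarrow> bool" where
  "alternates 0 p ps \<longleftrightarrow> True"
| "alternates (Suc m) p ps \<longleftrightarrow> (\<exists>t<length ps. ps ! t = p \<and> alternates m (opposite p) (take t ps))"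

lemma alternates_take_mono:
  assumes "alternates m p (take s ps)" "s \<le> t"
  shows "alternates m p (take t ps)"
proof (cases m)
  case (Suc l)
  with assms(1) obtain r where "r < length ps" "r < s" "ps ! r = p"
    "alternates l (opposite p) (take r ps)"
    by (auto simp: min_def split: if_splits)
  with assms(2) show ?thesis
    unfolding Suc alternates.simps(2) by (intro exI[of _ r]) (simp add: min_absorb1)
qed simp

text \<open>Ending the subsequence at the last \<open>p\<close> is the best choice, because it
  leaves the longest prefix for the remaining entries.\<close>

lemma alternates_Suc_last:
  assumes "t < length ps" "ps ! t = p" "\<And>s. t < s \<Longrightarrow> s < length ps \<Longrightarrow> ps ! s \<noteq> p"
  shows "alternates (Suc m) p ps \<longleftrightarrow> alternates m (opposite p) (take t ps)"
proof
  assume "alternates (Suc m) p ps"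
  then obtain s where s: "s < length ps" "ps ! s = p" "alternates m (opposite p) (take s ps)"
    by auto
  have "s \<le> t"
    using assms(3)[of s] s by (cases "s \<le> t") auto
  with s(3) show "alternates m (opposite p) (take t ps)"
    by (rule alternates_take_mono)
qed (use assms in auto)

lemma alternates_take_iff:
  assumes "\<And>s. t \<le> s \<Longrightarrow> s < length ps \<Longrightarrow> ps ! s \<noteq> p"
  shows "alternates m p ps \<longleftrightarrow> alternates m p (take t ps)"
proof
  assume "alternates m p ps"
  then show "alternates m p (take t ps)"
  proof (cases m)
    case (Suc l)
    with \<open>alternates m p ps\<close> obtain r where r: "r < length ps" "ps ! r = p"
      "alternates l (opposite p) (take r ps)"
      by auto
    have "r < t" using assms[of r] r by (cases "r < t") auto
    with r show ?thesis
      unfolding Suc alternates.simps(2) by (intro exI[of _ r]) (simp add: min_absorb1)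
  qed simp
next
  assume "alternates m p (take t ps)"
  then show "alternates m p ps"
    using alternates_take_mono[of m p t ps "max t (length ps)"] by simp
qed

lemma alternates_map_opposite:
  "alternates m (opposite p) (map opposite ps) \<longleftrightarrow> alternates m p ps"
proof (induction m arbitrary: p ps)
  case (Suc m)
  show ?case
    using Suc[of "opposite p"] by (auto simp: take_map)
qed simp

section \<open>Integer columns and the exchange of row prefixes\<close>

definition column_sign :: "int \<Rightarrow> int \<Rightarrow> int \<Rightarrow> int \<Rightarrow> parity" where
  "column_sign k i a b =
     (if a - b \<ge> k - i - 1 then Positive else if a - b \<le> 1 - i then Negative else Neutral)"

lemma column_sign_eq_Negative_iff:
  "k \<ge> 3 \<Longrightarrow> column_sign k i a b = Negative \<longleftrightarrow> a - b \<le> 1 - i"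
  by (auto simp: column_sign_def)

text \<open>The exchange sends the difference x = a - b to 4 - 2 i - x. This reflection carries 1 -
  i to 3 - i and k - i - 1 to 5 - i - k, which are the positive and the negative threshold for the
  parameter \<open>i + k - 4\<close>.\<close>

lemma column_sign_exchange:
  "k \<ge> 3 \<Longrightarrow> column_sign k (i + k - 4) (b - (i - 2)) (a + (i - 2)) = opposite (column_sign k i a b)"
  by (auto simp: column_sign_def)

text \<open>Counted from 1, with the value 0 if there is no negative column.\<close>

definition last_negative :: "int \<Rightarrow> int list \<Rightarrow> int list \<Rightarrow> nat" where
  "last_negative i as bs =
     Max (insert 0 {Suc s | s. s < length as \<and> s < length bs \<and> as ! s - bs ! s \<le> 1 - i})"

lemma last_negative_eqI:
  assumes "t \<le> length as" "t \<le> length bs" "t > 0 \<Longrightarrow> as ! (t - 1) - bs ! (t - 1) \<le> 1 - i"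
    "\<And>s. t \<le> s \<Longrightarrow> s < length as \<Longrightarrow> s < length bs \<Longrightarrow> as ! s - bs ! s > 1 - i"
  shows "last_negative i as bs = t"
  unfolding last_negative_def
proof (rule Max_eqI)
  show "finite (insert 0 {Suc s | s. s < length as \<and> s < length bs \<and> as ! s - bs ! s \<le> 1 - i})"
    by simp
  show "y \<le> t" if "y \<in> insert 0 {Suc s | s. s < length as \<and> s < length bs \<and> as ! s - bs ! s \<le> 1 - i}" for y
    using that assms(4) by (force simp: not_less_eq_eq[symmetric])
  show "t \<in> insert 0 {Suc s | s. s < length as \<and> s < length bs \<and> as ! s - bs ! s \<le> 1 - i}"
    using assms(1-3) by (cases t) auto
qed

lemma last_negative:
  shows "last_negative i as bs \<le> length as" and "last_negative i as bs \<le> length bs"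
    and "last_negative i as bs > 0 \<Longrightarrow>
       as ! (last_negative i as bs - 1) - bs ! (last_negative i as bs - 1) \<le> 1 - i"
    and "\<And>s. last_negative i as bs \<le> s \<Longrightarrow> s < length as \<Longrightarrow> s < length bs \<Longrightarrow> as ! s - bs ! s > 1 - i"
proof -
  let ?A = "insert 0 {Suc s | s. s < length as \<and> s < length bs \<and> as ! s - bs ! s \<le> 1 - i}"
  have fin: "finite ?A" by simp
  have "last_negative i as bs \<in> ?A"
    unfolding last_negative_def by (rule Max_in) auto
  then show "last_negative i as bs \<le> length as" and "last_negative i as bs \<le> length bs"
    and "last_negative i as bs > 0 \<Longrightarrow>
       as ! (last_negative i as bs - 1) - bs ! (last_negative i as bs - 1) \<le> 1 - i"
    by auto
  show "as ! s - bs ! s > 1 - i" if "last_negative i as bs \<le> s" "s < length as" "s < length bs" for s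
  proof (rule ccontr)
    assume "\<not> ?thesis"
    then have "Suc s \<in> ?A" using that by simp
    with fin have "Suc s \<le> last_negative i as bs"
      unfolding last_negative_def by (rule Max_ge)
    with that(1) show False by simp
  qed
qed

text \<open>The prefixes may differ in length, so that the charge can change. The opposite shifts
  make the exchange with \<open>p\<close> and \<open>q\<close> swapped its inverse.\<close>

definition exchange :: "int \<Rightarrow> nat \<Rightarrow> nat \<Rightarrow> int list \<times> int list \<Rightarrow> int list \<times> int list" where
  "exchange d p q = (\<lambda>(as, bs).
     (map (\<lambda>b. b - d) (take q bs) @ drop p as, map (\<lambda>a. a + d) (take p as) @ drop q bs))"

lemma exchange_exchange:
  "p \<le> length as \<Longrightarrow> q \<le> length bs \<Longrightarrow> exchange d q p (exchange d p q (as, bs)) = (as, bs)"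
  by (simp add: exchange_def comp_def min_absorb2)

lemma strict_decreasing_nth_mono:
  fixes xs :: "int list"
  assumes "sorted_wrt (>) xs" "s \<le> t" "t < length xs"
  shows "xs ! t \<le> xs ! s"
  using assms by (cases "s = t") (auto simp: sorted_wrt_iff_nth_less intro: less_imp_le)

text \<open>Both pieces inherit their order, so only the junction is at stake: the last moved entry
  against the first retained one.\<close>

lemma strict_decreasing_splice:
  fixes xs ys :: "int list"
  assumes "sorted_wrt (>) xs" "sorted_wrt (>) ys" "q \<le> length ys"
    "q > 0 \<Longrightarrow> p < length xs \<Longrightarrow> ys ! (q - 1) - d > xs ! p"
  shows "sorted_wrt (>) (map (\<lambda>y. y - d) (take q ys) @ drop p xs)"
  unfolding sorted_wrt_append
proof (intro conjI ballI)
  fix x y assume "x \<in> set (map (\<lambda>y. y - d) (take q ys))" "y \<in> set (drop p xs)"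
  then obtain s t where st: "s < q" "x = ys ! s - d" "t < length xs - p" "y = xs ! (p + t)"
    using assms(3) by (auto simp: in_set_conv_nth)
  have "ys ! (q - 1) \<le> ys ! s" "xs ! (p + t) \<le> xs ! p"
    using st assms(1-3) by (auto intro!: strict_decreasing_nth_mono)
  moreover have "ys ! (q - 1) - d > xs ! p"
    using st by (intro assms(4)) auto
  ultimately show "x > y" using st by simp
qed (use assms in \<open>simp_all add: sorted_wrt_map_diff sorted_wrt_take sorted_wrt_drop\<close>)

lemma nonneg_splice:
  fixes xs ys :: "int list"
  assumes "sorted_wrt (>) ys" "q \<le> length ys" "q > 0 \<Longrightarrow> ys ! (q - 1) - d \<ge> 0" "\<forall>x\<in>set xs. 0 \<le> x"
  shows "\<forall>x \<in> set (map (\<lambda>y. y - d) (take q ys) @ drop p xs). 0 \<le> x"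
proof -
  have "0 \<le> ys ! s - d" if "s < q" for s
  proof -
    have "ys ! (q - 1) \<le> ys ! s"
      using assms(1,2) that by (intro strict_decreasing_nth_mono) auto
    then show ?thesis
      using assms(3) that by simp
  qed
  moreover have "\<exists>s<q. y = ys ! s" if "y \<in> set (take q ys)" for y
    using that assms(2) by (auto simp: in_set_conv_nth)
  ultimately show ?thesis
    using assms(4) by (auto dest!: in_set_dropD) fastforce
qed

text \<open>The inequalities are the junction and nonnegativity conditions for the two new rows. The
  shifts change the weight by d (p - q), and the new length of the bottom row adds another p -
  q.\<close>

lemma exchange_charged_pairs:
  assumes "(as, bs) \<in> charged_pairs c E" "p \<le> length as" "q \<le> length bs"
    "q > 0 \<Longrightarrow> p < length as \<Longrightarrow> bs ! (q - 1) - d > as ! p"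
    "p > 0 \<Longrightarrow> q < length bs \<Longrightarrow> as ! (p - 1) + d > bs ! q"
    "q > 0 \<Longrightarrow> bs ! (q - 1) - d \<ge> 0"
    "p > 0 \<Longrightarrow> as ! (p - 1) + d \<ge> 0"
    "c' + 2 * p = c + 2 * q"
  shows "exchange d p q (as, bs) \<in> charged_pairs c' (E + (d + 1) * (int p - int q))"
proof -
  have 1: "sorted_wrt (>) as" "sorted_wrt (>) bs" "\<forall>x\<in>set as. 0 \<le> x" "\<forall>x\<in>set bs. 0 \<le> x"
    "length as = length bs + c" "sum_list as + sum_list bs + int (length bs) = E"
    using assms(1) by (auto simp: charged_pairs_def)
  have "sum_list (take p as) + sum_list (drop p as) = sum_list as"
    "sum_list (take q bs) + sum_list (drop q bs) = sum_list bs"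
    by (simp_all flip: sum_list_append)
  then have "sum_list (map (\<lambda>b. b - d) (take q bs) @ drop p as) +
      sum_list (map (\<lambda>a. a + d) (take p as) @ drop q bs) =
      sum_list as + sum_list bs + d * int p - d * int q"
    using assms(2,3) by (simp add: sum_list_map_add sum_list_map_diff min_absorb2)
  moreover have "int (length bs + p - q) = int (length bs) + int p - int q"
    using assms(3) by simp
  moreover have "sorted_wrt (>) (map (\<lambda>b. b - d) (take q bs) @ drop p as)"
    by (rule strict_decreasing_splice) (use 1 assms in auto)
  \<comment> \<open>The shift is written as a subtraction of \<open>- d\<close>, so that the splice
    lemmas cover the bottom row as well.\<close>
  moreover have "sorted_wrt (>) (map (\<lambda>a. a - - d) (take p as) @ drop q bs)"
    by (rule strict_decreasing_splice) (use 1 assms in auto)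
  moreover have "\<forall>x\<in>set (map (\<lambda>b. b - d) (take q bs) @ drop p as). 0 \<le> x"
    by (rule nonneg_splice) (use 1 assms in auto)
  moreover have "\<forall>x\<in>set (map (\<lambda>a. a - - d) (take p as) @ drop q bs). 0 \<le> x"
    by (rule nonneg_splice) (use 1 assms in auto)
  moreover have "length (map (\<lambda>b. b - d) (take q bs) @ drop p as) =
      length (map (\<lambda>a. a + d) (take p as) @ drop q bs) + c'"
    "length (map (\<lambda>a. a + d) (take p as) @ drop q bs) = length bs + p - q"
    using 1(5) assms(2,3,8) by (auto simp: min_absorb2)
  ultimately show ?thesis
    using 1(6) unfolding charged_pairs_def exchange_def
    by (simp only: mem_Collect_eq split_conv diff_minus_eq_add ball_Un) (simp add: algebra_simps)
qed

text \<open>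
  The shift \<open>i - 2\<close> makes the exchange at the last negative column preserve strict decrease. The
  invariant \<open>c + i \<ge> 1\<close> keeps the shifted entries nonnegative, since \<open>i\<close> may become negative when
  \<open>k = 3\<close>.
\<close>

context
  fixes k i :: int and c :: nat
  assumes k: "k \<ge> 3" and c: "int c + i \<ge> 1"
begin

lemma exchange_forward:
  assumes pair: "(as, bs) \<in> charged_pairs c E"
    and u: "u < length bs" "as ! u - bs ! u \<le> 1 - i"
    and later: "\<And>s. u < s \<Longrightarrow> s < length bs \<Longrightarrow> as ! s - bs ! s > 1 - i"
    and ex: "exchange (i - 2) u (Suc u) (as, bs) = (as', bs')"
  shows "(as', bs') \<in> charged_pairs (c + 2) (E - i + 1)"
    and "last_negative i (drop 2 as') bs' = u"
    and "alternates m Negative (map2 (column_sign k (i + k - 4)) as' bs') \<longleftrightarrow>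
         alternates (Suc m) Negative (map2 (column_sign k i) as bs)"
proof -
  have as: "sorted_wrt (>) as" "\<forall>x\<in>set as. 0 \<le> x" and bs: "sorted_wrt (>) bs" "\<forall>x\<in>set bs. 0 \<le> x"
    and len: "length as = length bs + c"
    using pair by (auto simp: charged_pairs_def)
  have dec_as: "as ! t < as ! s" if "s < t" "t < length as" for s t
    using as that by (simp add: sorted_wrt_iff_nth_less)
  have "as ! u \<ge> 0" using as(2) u(1) len by simp
  \<comment> \<open>Column \<open>u + 1\<close> is not negative, so its top entry plus
    \<open>i - 2\<close> is at least its bottom entry; the larger top entry at \<open>u - 1\<close>
    makes the inequality strict.\<close>
  have "as ! (u - 1) + (i - 2) > bs ! Suc u" if "u > 0" "Suc u < length bs"
    using dec_as[of "u - 1" u] dec_as[of u "Suc u"] later[of "Suc u"] that len by simp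
  moreover have "as ! (u - 1) + (i - 2) \<ge> 0" if "u > 0"
  proof -
    \<comment> \<open>At least c + 1 entries follow position \<open>u - 1\<close> in the top row, so
      the entry there is at least c + 1, and the invariant \<open>c + i \<ge> 1\<close> pays for the
      shift.\<close>
    have "int (length as) - 1 - int (u - 1) \<le> as ! (u - 1)"
      using u(1) len by (intro strict_decreasing_nth_ge as) simp
    then show ?thesis
      using c len u(1) that by linarith
  qed
  ultimately show "(as', bs') \<in> charged_pairs (c + 2) (E - i + 1)"
    using exchange_charged_pairs[OF pair, of u "Suc u" "i - 2" "c + 2"] \<open>as ! u \<ge> 0\<close> u len
    unfolding ex by (simp add: algebra_simps)
  have as': "as' = map (\<lambda>b. b - (i - 2)) (take (Suc u) bs) @ drop u as"
    and bs': "bs' = map (\<lambda>a. a + (i - 2)) (take u as) @ drop (Suc u) bs"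
    using ex by (auto simp: exchange_def)
  have len': "length as' = Suc (length as)" "Suc (length bs') = length bs"
    using u(1) len by (auto simp: as' bs')
  have as'_low: "as' ! s = bs ! s - (i - 2)" if "s \<le> u" for s
    using that u(1) by (simp add: as' nth_append)
  have as'_high: "as' ! Suc s = as ! s" if "u \<le> s" "s < length as" for s
    using that u(1) by (simp add: as' nth_append)
  have bs'_low: "bs' ! s = as ! s + (i - 2)" if "s < u" for s
    using that u(1) len by (simp add: bs' nth_append)
  have bs'_high: "bs' ! s = bs ! Suc s" if "u \<le> s" "Suc s < length bs" for s
    using that u(1) len by (simp add: bs' nth_append)
  show "last_negative i (drop 2 as') bs' = u"
  proof (rule last_negative_eqI)
    show "u \<le> length (drop 2 as')" "u \<le> length bs'"
      using len' len u(1) by auto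
    \<comment> \<open>This column pairs the old top entry at \<open>u\<close> with the shifted old
      top entry at \<open>u - 1\<close>, so strict decrease makes it negative.\<close>
    show "drop 2 as' ! (u - 1) - bs' ! (u - 1) \<le> 1 - i" if "u > 0"
      using that as'_high[of u] bs'_low[of "u - 1"] dec_as[of "u - 1" u] u(1) len len' by simp
    \<comment> \<open>From \<open>u\<close> on these are the old columns \<open>s + 1\<close>, all
      to the right of the last negative one.\<close>
    show "drop 2 as' ! s - bs' ! s > 1 - i" if "u \<le> s" "s < length (drop 2 as')" "s < length bs'" for s
      using that as'_high[of "Suc s"] bs'_high[of s] later[of "Suc s"] len len' by simp
  qed
  let ?ps = "map2 (column_sign k i) as bs" and ?ps' = "map2 (column_sign k (i + k - 4)) as' bs'"
  have "take u ?ps' = map opposite (take u ?ps)"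
    using len len' u(1) column_sign_exchange[OF k]
    by (intro nth_equalityI) (auto simp: as'_low bs'_low)
  moreover have "?ps' ! s \<noteq> Negative" if "u \<le> s" "s < length ?ps'" for s
  proof -
    have s: "Suc s < length bs" using that len len' by simp
    \<comment> \<open>The negative threshold for the parameter \<open>i + k - 4\<close> is 5 - i -
      k, which is at most 2 - i since k \<ge> 3.\<close>
    have "as' ! s - bs' ! s > 2 - i"
    proof (cases "s = u")
      case True
      then show ?thesis
        using as'_low[of s] bs'_high[of s] s bs(1)
        unfolding sorted_wrt_iff_nth_less by force
    next
      case False
      with \<open>u \<le> s\<close> obtain r where "s = Suc r" "u \<le> r" by (cases s) auto
      then show ?thesis
        using as'_high[of r] bs'_high[of s] s dec_as[of r "Suc s"] later[of "Suc s"] len by simp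
    qed
    with s show ?thesis
      using len len' k by (simp add: column_sign_eq_Negative_iff[OF k])
  qed
  moreover have "?ps ! u = Negative" "u < length ?ps"
    using u len by (simp_all add: column_sign_eq_Negative_iff[OF k])
  moreover have "?ps ! s \<noteq> Negative" if "u < s" "s < length ?ps" for s
    using later[of s] that len by (simp add: column_sign_eq_Negative_iff[OF k])
  \<comment> \<open>In the new pair only the first \<open>u\<close> columns can matter; they are the
    flipped old ones; and in the old pair column \<open>u\<close> is the end of the longer
    alternation.\<close>
  ultimately show "alternates m Negative ?ps' \<longleftrightarrow> alternates (Suc m) Negative ?ps"
    using alternates_take_iff[of u ?ps' Negative m] alternates_Suc_last[of u ?ps Negative m]
      alternates_map_opposite[of m Positive "take u ?ps"] by simp
qed

text \<open>
  After the exchange, column \<open>s\<close> of the old bottom row faces column \<open>s + 2\<close> of the new top row, so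
  the exchange position is recovered from the pair whose top row has lost its first two entries.
\<close>

lemma exchange_backward:
  assumes pair: "(as', bs') \<in> charged_pairs (c + 2) (E - i + 1)"
    and u: "u = last_negative i (drop 2 as') bs'"
    and ex: "exchange (i - 2) (Suc u) u (as', bs') = (as, bs)"
  shows "(as, bs) \<in> charged_pairs c E" and "u < length bs" and "as ! u - bs ! u \<le> 1 - i"
    and "\<And>s. u < s \<Longrightarrow> s < length bs \<Longrightarrow> as ! s - bs ! s > 1 - i"
    and "exchange (i - 2) u (Suc u) (as, bs) = (as', bs')"
    and "last_negative i as bs = Suc u"
proof -
  have as': "sorted_wrt (>) as'" "\<forall>x\<in>set as'. 0 \<le> x" and bs': "sorted_wrt (>) bs'" "\<forall>x\<in>set bs'. 0 \<le> x"
    and len': "length as' = length bs' + c + 2"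
    using pair by (auto simp: charged_pairs_def)
  have u_le: "u \<le> length bs'"
    unfolding u by (rule last_negative)
  have at: "as' ! Suc u - bs' ! (u - 1) \<le> 1 - i" if "u > 0"
    using last_negative(3)[of i "drop 2 as'" bs', folded u, OF that] that u_le len' by simp
  have after: "as' ! Suc (Suc s) - bs' ! s > 1 - i" if "u \<le> s" "s < length bs'" for s
    using last_negative(4)[of i "drop 2 as'" bs' s, folded u] that len' by simp
  have dec_as': "as' ! t < as' ! s" if "s < t" "t < length as'" for s t
    using as' that by (simp add: sorted_wrt_iff_nth_less)
  have "as' ! Suc u \<ge> 0" using as'(2) u_le len' by simp
  have "as' ! u + (i - 2) > bs' ! u" if "u < length bs'"
    using dec_as'[of u "Suc u"] dec_as'[of "Suc u" "Suc (Suc u)"] after[of u] that len' by simp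
  \<comment> \<open>At least c + 1 entries follow position \<open>u\<close> in \<open>as'\<close>,
    so the invariant applies again.\<close>
  moreover have "as' ! u + (i - 2) \<ge> 0"
    using strict_decreasing_nth_ge[OF as', of u] c len' u_le by simp
  ultimately show "(as, bs) \<in> charged_pairs c E"
    using exchange_charged_pairs[OF pair, of "Suc u" u "i - 2" c] \<open>as' ! Suc u \<ge> 0\<close> u_le at len'
    unfolding ex by fastforce
  have as: "as = map (\<lambda>b. b - (i - 2)) (take u bs') @ drop (Suc u) as'"
    and bs: "bs = map (\<lambda>a. a + (i - 2)) (take (Suc u) as') @ drop u bs'"
    using ex by (auto simp: exchange_def)
  have len: "length bs = Suc (length bs')" "length as = length bs + c"
    using u_le len' by (auto simp: as bs)
  show "u < length bs"
    using len u_le by simp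
  \<comment> \<open>Both entries of column \<open>u\<close> come from \<open>as'\<close>, namely
    from its consecutive positions \<open>u + 1\<close> and \<open>u\<close>, so strict decrease
    alone makes the column negative, also for u = 0.\<close>
  show neg: "as ! u - bs ! u \<le> 1 - i"
    using u_le len' dec_as'[of u "Suc u"] by (simp add: as bs nth_append)
  show later: "as ! s - bs ! s > 1 - i" if "u < s" "s < length bs" for s
    using that u_le len len' after[of "s - 1"] by (simp add: as bs nth_append)
  show "exchange (i - 2) u (Suc u) (as, bs) = (as', bs')"
    using exchange_exchange[of "Suc u" as' u bs' "i - 2"] u_le len' ex by simp
  show "last_negative i as bs = Suc u"
    using len u_le neg later by (intro last_negative_eqI) auto
qed

text \<open>One exchange trades the last column of the alternation for 2 units of charge and the
  parameter \<open>i + k - 4\<close>. Since \<open>map2\<close> stops at the shorter row, the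
  surplus top entries form no columns.\<close>

lemma card_alternating_Suc:
  "card {(as, bs) \<in> charged_pairs c E. alternates (Suc m) Negative (map2 (column_sign k i) as bs)} =
   card {(as, bs) \<in> charged_pairs (c + 2) (E - i + 1).
           alternates m Negative (map2 (column_sign k (i + k - 4)) as bs)}"
  (is "card ?S = card ?T")
proof -
  \<comment> \<open>\<open>last_negative\<close> counts from 1: the bottom prefix includes the last
    negative column, the top prefix stops just before it.\<close>
  let ?f = "\<lambda>(as, bs). exchange (i - 2) (last_negative i as bs - 1) (last_negative i as bs) (as, bs)"
  let ?g = "\<lambda>(as, bs). exchange (i - 2) (Suc (last_negative i (drop 2 as) bs))
    (last_negative i (drop 2 as) bs) (as, bs)"
  have f: "?f p \<in> ?T \<and> ?g (?f p) = p" if p: "p \<in> ?S" for p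
  proof -
    obtain as bs where pq: "p = (as, bs)" by force
    have pair: "(as, bs) \<in> charged_pairs c E" and
      alt: "alternates (Suc m) Negative (map2 (column_sign k i) as bs)"
      using p by (auto simp: pq)
    have len: "length as = length bs + c"
      using pair by (simp add: charged_pairs_def)
    obtain t where t: "t < length bs" "as ! t - bs ! t \<le> 1 - i"
      using alt len by (auto simp: column_sign_eq_Negative_iff[OF k])
    define u where "u = last_negative i as bs - 1"
    \<comment> \<open>A negative column exists, so the subtraction of 1 in \<open>?f\<close> does
      not truncate.\<close>
    have "last_negative i as bs > 0"
      using last_negative(4)[of i as bs t] t len by (cases "last_negative i as bs") auto
    then have u: "last_negative i as bs = Suc u" "u < length bs" "as ! u - bs ! u \<le> 1 - i"
      using last_negative(2,3)[of i as bs] by (auto simp: u_def)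
    have later: "as ! s - bs ! s > 1 - i" if "u < s" "s < length bs" for s
      using last_negative(4)[of i as bs s] that u(1) len by simp
    obtain as' bs' where ex: "exchange (i - 2) u (Suc u) (as, bs) = (as', bs')"
      by force
    have "(as', bs') \<in> ?T"
      using exchange_forward(1,3)[OF pair u(2,3) later ex] alt by auto
    moreover have "?f p = (as', bs')"
      using ex u(1) by (simp add: pq)
    moreover have "?g (as', bs') = p"
      using exchange_forward(2)[OF pair u(2,3) later ex] exchange_exchange[of u as "Suc u" bs "i - 2"]
        ex u(2) len by (simp add: pq)
    ultimately show ?thesis by simp
  qed
  have g: "?g p \<in> ?S \<and> ?f (?g p) = p" if p: "p \<in> ?T" for p
  proof -
    obtain as' bs' where pq: "p = (as', bs')" by force
    have pair: "(as', bs') \<in> charged_pairs (c + 2) (E - i + 1)" and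
      alt: "alternates m Negative (map2 (column_sign k (i + k - 4)) as' bs')"
      using p by (auto simp: pq)
    define u where "u = last_negative i (drop 2 as') bs'"
    obtain as bs where ex: "exchange (i - 2) (Suc u) u (as', bs') = (as, bs)"
      by force
    note b = exchange_backward[OF pair u_def ex]
    have "(as, bs) \<in> ?S"
      using exchange_forward(3)[OF b(1-5)] alt b(1) by auto
    moreover have "?g p = (as, bs)"
      using ex by (simp add: pq u_def)
    ultimately show ?thesis
      using b(5,6) by (simp add: pq)
  qed
  have "bij_betw ?f ?S ?T"
    by (rule bij_betw_byWitness[where f' = ?g])
      (intro ballI image_subsetI conjunct1[OF f] conjunct2[OF f] conjunct1[OF g] conjunct2[OF g], assumption)+
  then show ?thesis
    by (rule bij_betw_same_card)
qed

end

text \<open>An exchange lowers N by \<open>i + 2 * c\<close>, and this quantity then grows by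
  \<open>k\<close>, because \<open>i\<close> grows by \<open>k - 4\<close> and \<open>c\<close> by
  2. Summing over \<open>m\<close> exchanges gives the subtracted amount. The invariant persists
  since c + i grows by k - 2.\<close>

lemma card_alternating:
  assumes "k \<ge> 3" "int c + i \<ge> 1"
  shows "card {(as, bs) \<in> charged_pairs c (N + int (c choose 2)).
            alternates m Negative (map2 (column_sign k i) as bs)} =
         partition_count (N - k * int (m choose 2) - (i + 2 * int c) * int m)"
  using assms(2)
proof (induction m arbitrary: c i N)
  case 0
  then show ?case
    by (simp add: card_charged_pairs binomial_eq_0)
next
  case (Suc m)
  have E: "N + int (c choose 2) - i + 1 = (N - i - 2 * int c) + int ((c + 2) choose 2)"
    by (simp add: numeral_2_eq_2)
  have result: "N - i - 2 * int c - k * int (m choose 2) - (i + k - 4 + 2 * int (c + 2)) * int m =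
      N - k * int (Suc m choose 2) - (i + 2 * int c) * int (Suc m)"
    by (simp add: numeral_2_eq_2 algebra_simps)
  have "int (c + 2) + (i + k - 4) \<ge> 1"
    using assms(1) Suc.prems by simp
  then show ?case
    unfolding card_alternating_Suc[OF assms(1) Suc.prems] E
    by (subst Suc.IH) (simp_all only: result)
qed

section \<open>Frobenius symbols as pairs of charge 0\<close>

lemma card_frobenius_Negative:
  assumes "k \<ge> 3" "i \<ge> 1"
  shows "card {xs. frobenius_symbol n xs \<and> alternates m Negative (map (column_parity k i) xs)} =
    partition_count (int n - k * int (m choose 2) - i * int m)"
proof -
  let ?f = "\<lambda>xs :: symbol. (map (int \<circ> fst) xs, map (int \<circ> snd) xs)"
  let ?g = "\<lambda>(as, bs). zip (map nat as) (map nat bs)"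
  let ?S = "{xs. frobenius_symbol n xs \<and> alternates m Negative (map (column_parity k i) xs)}"
  let ?T = "{(as, bs) \<in> charged_pairs 0 (int n). alternates m Negative (map2 (column_sign k i) as bs)}"
  have signs: "map2 (column_sign k i) (map (int \<circ> fst) xs) (map (int \<circ> snd) xs) =
      map (column_parity k i) xs" for xs
    by (induction xs) (auto simp: column_sign_def column_parity_def)
  have energy: "sum_list (map (int \<circ> fst) xs) + sum_list (map (int \<circ> snd) xs) + int (length xs) =
      int (\<Sum>(a, b) \<leftarrow> xs. a + b + 1)" for xs
    by (induction xs) auto
  have sorted_int: "sorted_wrt (>) (map (int \<circ> h) xs) \<longleftrightarrow> sorted_wrt (>) (map h xs)"
    for h :: "nat \<times> nat \<Rightarrow> nat" and xs
    by (simp add: sorted_wrt_map)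
  have f: "?f xs \<in> ?T \<longleftrightarrow> xs \<in> ?S" for xs
    using energy[of xs] by (auto simp: charged_pairs_def signs sorted_int frobenius_symbol_def)
  \<comment> \<open>The entries are nonnegative and the rows equally long, so neither
    \<open>nat\<close> nor \<open>zip\<close> loses information.\<close>
  have fg: "?f (?g p) = p" if "p \<in> ?T" for p
    using that by (auto simp: charged_pairs_def intro!: nth_equalityI)
  have "bij_betw ?f ?S ?T"
  proof (rule bij_betw_byWitness[where f' = ?g])
    show "\<forall>xs\<in>?S. ?g (?f xs) = xs"
      by (simp add: comp_def zip_map_fst_snd)
    show "\<forall>p\<in>?T. ?f (?g p) = p"
      using fg by blast
    show "?f ` ?S \<subseteq> ?T"
      using f by blast
    show "?g ` ?T \<subseteq> ?S"
    proof (rule image_subsetI)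
      fix p assume "p \<in> ?T"
      then show "?g p \<in> ?S"
        using f[of "?g p"] fg[of p] by simp
    qed
  qed
  then have "card ?S = card ?T"
    by (rule bij_betw_same_card)
  also have "\<dots> = partition_count (int n - k * int (m choose 2) - i * int m)"
    using card_alternating[of k 0 i "int n" m] assms by (simp add: binomial_eq_0)
  finally show ?thesis .
qed

lemma card_frobenius_Positive:
  assumes "k \<ge> 3" "i \<le> k - 1"
  shows "card {xs. frobenius_symbol n xs \<and> alternates m Positive (map (column_parity k i) xs)} =
    partition_count (int n - k * int ((m + 1) choose 2) + i * int m)"
proof -
  let ?f = "map prod.swap :: symbol \<Rightarrow> symbol"
  let ?S = "{xs. frobenius_symbol n xs \<and> alternates m Positive (map (column_parity k i) xs)}"
  let ?T = "{xs. frobenius_symbol n xs \<and> alternates m Negative (map (column_parity k (k - i)) xs)}"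
  have signs: "map (column_parity k (k - i)) (?f xs) = map opposite (map (column_parity k i) xs)" for xs
    using assms(1) by (auto simp: column_parity_def)
  have frobenius: "frobenius_symbol n (?f xs) \<longleftrightarrow> frobenius_symbol n xs" for xs
  proof -
    have "(\<Sum>(a, b) \<leftarrow> ?f xs. a + b + 1) = (\<Sum>(a, b) \<leftarrow> xs. a + b + 1)"
      by (induction xs) auto
    then show ?thesis
      by (auto simp: frobenius_symbol_def comp_def)
  qed
  have f: "?f xs \<in> ?T \<longleftrightarrow> xs \<in> ?S" for xs
    using alternates_map_opposite[of m Positive "map (column_parity k i) xs"]
    unfolding mem_Collect_eq signs frobenius by simp
  have ff: "?f (?f xs) = xs" for xs
    by (simp add: comp_def)
  have "bij_betw ?f ?S ?T"
  proof (rule bij_betw_byWitness[where f' = ?f])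
    show "?f ` ?S \<subseteq> ?T"
      using f by blast
    show "?f ` ?T \<subseteq> ?S"
    proof (rule image_subsetI)
      fix xs assume "xs \<in> ?T"
      then show "?f xs \<in> ?S"
        using f[of "?f xs"] unfolding ff by blast
    qed
  qed (simp_all only: ff simp_thms ball_simps)
  then have "card ?S = card ?T"
    by (rule bij_betw_same_card)
  also have "\<dots> = partition_count (int n - k * int (m choose 2) - (k - i) * int m)"
    using assms by (intro card_frobenius_Negative) auto
  \<comment> \<open>The extra term k m turns \<open>m choose 2\<close> into
    \<open>(m + 1) choose 2\<close>.\<close>
  also have "int n - k * int (m choose 2) - (k - i) * int m =
      int n - k * int ((m + 1) choose 2) + i * int m"
    by (simp add: numeral_2_eq_2 algebra_simps)
  finally show ?thesis .
qed

section \<open>Blocks and dotted blocks\<close>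

definition block_parity :: "int \<Rightarrow> int \<Rightarrow> symbol \<Rightarrow> nat set \<Rightarrow> parity" where
  "block_parity k i xs B = column_parity k i (xs ! anchor k i xs B)"

text \<open>The parity of a block forces the row in which its anchor is overlined, so an overlining
  is encoded by the set \<open>J\<close> of list indices of the blocks concerned.\<close>

definition marked_symbol :: "int \<Rightarrow> int \<Rightarrow> symbol \<Rightarrow> nat set \<Rightarrow> overlined_symbol" where
  "marked_symbol k i xs J = (let Bs = non_neutral_blocks k i xs in
     (xs, (\<lambda>j. anchor k i xs (Bs ! j)) ` {j \<in> J. block_parity k i xs (Bs ! j) = Positive},
          (\<lambda>j. anchor k i xs (Bs ! j)) ` {j \<in> J. block_parity k i xs (Bs ! j) = Negative}))"

lemma fst_marked_symbol [simp]: "fst (marked_symbol k i xs J) = xs"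
  by (simp add: marked_symbol_def Let_def)

context
  fixes k i :: int and xs :: symbol
begin

abbreviation (input) "cpar t \<equiv> column_parity k i (xs ! t)"
abbreviation (input) "blocks \<equiv> non_neutral_blocks k i xs"
abbreviation (input) "nncols \<equiv> non_neutral_columns k i xs"
abbreviation (input) "bpar \<equiv> block_parity k i xs"

lemma block_from_less:
  assumes "s < s'" "block_start k i xs s'" "t \<in> block_from k i xs s" "t' \<in> block_from k i xs s'"
  shows "t < t'"
proof -
  have "t < s'"
    using assms by (auto simp: block_from_def not_le[symmetric])
  then show ?thesis
    using assms(4) by (simp add: block_from_def)
qed

lemma ex_block_from:
  assumes "t < length xs"
  shows "\<exists>s. block_start k i xs s \<and> t \<in> block_from k i xs s"
proof -
  let ?A = "{s. s \<le> t \<and> block_start k i xs s}"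
  have fin: "finite ?A" by simp
  have "0 \<in> ?A" using assms by (auto simp: block_start_def)
  then have "Max ?A \<in> ?A" using fin by (intro Max_in) auto
  then have "Max ?A \<le> t" "block_start k i xs (Max ?A)" by simp_all
  moreover have "\<not> block_start k i xs r" if "Max ?A < r" "r \<le> t" for r
  proof
    assume "block_start k i xs r"
    then have "r \<le> Max ?A" using that fin by (intro Max_ge) auto
    with that(1) show False by simp
  qed
  ultimately show ?thesis
    using assms unfolding block_from_def by blast
qed

lemma ex_previous_non_neutral:
  assumes "t < r" "cpar t \<noteq> Neutral"
  shows "\<exists>s. t \<le> s \<and> s < r \<and> cpar s \<noteq> Neutral \<and> (\<forall>q. s < q \<and> q < r \<longrightarrow> cpar q = Neutral)"
proof -
  let ?A = "{s. s < r \<and> cpar s \<noteq> Neutral}"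
  have fin: "finite ?A" by simp
  have t: "t \<in> ?A" using assms by simp
  then have "Max ?A \<in> ?A" using fin by (intro Max_in) auto
  then have "Max ?A < r" "cpar (Max ?A) \<noteq> Neutral" by simp_all
  moreover have "t \<le> Max ?A" using fin t by (rule Max_ge)
  moreover have "cpar q = Neutral" if "Max ?A < q" "q < r" for q
  proof (rule ccontr)
    assume "cpar q \<noteq> Neutral"
    then have "q \<le> Max ?A" using that fin by (intro Max_ge) auto
    with that(1) show False by simp
  qed
  ultimately show ?thesis by blast
qed

text \<open>Otherwise take the first non-neutral column \<open>r\<close> after \<open>t\<close> with
  another parity. The nearest non-neutral column on its left still has the parity of
  \<open>t\<close>, so a block starts at \<open>r\<close>, which separates \<open>t\<close> from
  \<open>t'\<close>.\<close>

lemma block_from_uniform_less: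
  assumes "t < t'" "t \<in> nncols (block_from k i xs s)" "t' \<in> nncols (block_from k i xs s)"
  shows "cpar t = cpar t'"
proof (rule ccontr)
  assume "cpar t \<noteq> cpar t'"
  define r where "r = (LEAST r. t < r \<and> cpar r \<noteq> Neutral \<and> cpar t \<noteq> cpar r)"
  have ex: "t < t' \<and> cpar t' \<noteq> Neutral \<and> cpar t \<noteq> cpar t'"
    using assms \<open>cpar t \<noteq> cpar t'\<close> by (simp add: non_neutral_columns_def)
  have r: "t < r" "cpar r \<noteq> Neutral" "cpar t \<noteq> cpar r"
    using LeastI[of "\<lambda>r. t < r \<and> cpar r \<noteq> Neutral \<and> cpar t \<noteq> cpar r", OF ex] unfolding r_def by auto
  have "r \<le> t'"
    unfolding r_def using ex by (rule Least_le)
  obtain q where q: "t \<le> q" "q < r" "cpar q \<noteq> Neutral" "\<forall>u. q < u \<and> u < r \<longrightarrow> cpar u = Neutral"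
    using ex_previous_non_neutral[OF r(1)] assms(2) by (auto simp: non_neutral_columns_def)
  have "cpar q = cpar t"
  proof (cases "q = t")
    case False
    with q(1) have "t < q" by simp
    with q(2,3) not_less_Least[of q "\<lambda>r. t < r \<and> cpar r \<noteq> Neutral \<and> cpar t \<noteq> cpar r"]
    show ?thesis by (auto simp: r_def)
  qed simp
  then have "block_start k i xs r"
    using q r \<open>r \<le> t'\<close> assms(3)
    by (auto simp: block_start_def non_neutral_columns_def block_from_def intro!: exI[of _ q])
  then show False
    using \<open>r \<le> t'\<close> r(1) assms(2,3) by (auto simp: non_neutral_columns_def block_from_def)
qed

lemma block_from_uniform:
  assumes "t \<in> nncols (block_from k i xs s)" "t' \<in> nncols (block_from k i xs s)"
  shows "cpar t = cpar t'"
proof (cases t t' rule: linorder_cases)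
  case less
  then show ?thesis using assms by (rule block_from_uniform_less)
next
  case greater
  then have "cpar t' = cpar t" using assms(2,1) by (rule block_from_uniform_less)
  then show ?thesis by (rule sym)
qed simp

lemma non_neutral_blocks_starts:
  obtains ss where "blocks = map (block_from k i xs) ss" "sorted_wrt (<) ss"
    "set ss = {s. block_start k i xs s \<and> nncols (block_from k i xs s) \<noteq> {}}"
proof
  let ?ss = "filter (\<lambda>s. nncols (block_from k i xs s) \<noteq> {}) (filter (block_start k i xs) [0..<length xs])"
  show "blocks = map (block_from k i xs) ?ss"
    by (simp only: non_neutral_blocks_def parity_blocks_def filter_map comp_def)
  show "sorted_wrt (<) ?ss"
    by (intro sorted_wrt_filter sorted_wrt_upt)
  show "set ?ss = {s. block_start k i xs s \<and> nncols (block_from k i xs s) \<noteq> {}}"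
    by (auto simp: block_start_def)
qed

lemma non_neutral_blocks_nth:
  assumes "j < length blocks"
  obtains s where "blocks ! j = block_from k i xs s" "block_start k i xs s" "nncols (blocks ! j) \<noteq> {}"
proof -
  obtain ss where ss: "blocks = map (block_from k i xs) ss"
    "set ss = {s. block_start k i xs s \<and> nncols (block_from k i xs s) \<noteq> {}}"
    by (rule non_neutral_blocks_starts)
  from assms ss(1) have "ss ! j \<in> set ss" by simp
  then have "block_start k i xs (ss ! j) \<and> nncols (block_from k i xs (ss ! j)) \<noteq> {}"
    unfolding ss(2) by simp
  with ss(1) assms show thesis by (intro that[of "ss ! j"]) auto
qed

lemma anchor_in_block:
  assumes "j < length blocks"
  shows "anchor k i xs (blocks ! j) \<in> nncols (blocks ! j)"
proof -
  obtain s where "blocks ! j = block_from k i xs s" "nncols (blocks ! j) \<noteq> {}"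
    using assms by (rule non_neutral_blocks_nth)
  then show ?thesis
    unfolding anchor_def
    by (intro Min_in) (auto simp: non_neutral_columns_def block_from_def)
qed

lemma block_column_parity:
  assumes "j < length blocks" "t \<in> nncols (blocks ! j)"
  shows "cpar t = bpar (blocks ! j)"
proof -
  obtain s where "blocks ! j = block_from k i xs s"
    using assms(1) by (rule non_neutral_blocks_nth)
  then show ?thesis
    using block_from_uniform[of t s] anchor_in_block[OF assms(1)] assms(2)
    by (simp add: block_parity_def)
qed

lemma block_parity_not_Neutral:
  "j < length blocks \<Longrightarrow> bpar (blocks ! j) \<noteq> Neutral"
  using anchor_in_block[of j] by (simp add: block_parity_def non_neutral_columns_def)

lemma positive_block_iff:
  assumes "j < length blocks"
  shows "positive_block k i xs (blocks ! j) \<longleftrightarrow> bpar (blocks ! j) = Positive"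
  unfolding positive_block_def
  using anchor_in_block[OF assms] block_column_parity[OF assms] by (metis empty_iff)

lemma negative_block_iff:
  assumes "j < length blocks"
  shows "negative_block k i xs (blocks ! j) \<longleftrightarrow> bpar (blocks ! j) = Negative"
  unfolding negative_block_def
  using anchor_in_block[OF assms] block_column_parity[OF assms] by (metis empty_iff)

lemma non_neutral_blocks_less:
  assumes "j < l" "l < length blocks" "t \<in> blocks ! j" "t' \<in> blocks ! l"
  shows "t < t'"
proof -
  obtain ss where ss: "blocks = map (block_from k i xs) ss" "sorted_wrt (<) ss"
    "set ss = {s. block_start k i xs s \<and> nncols (block_from k i xs s) \<noteq> {}}"
    by (rule non_neutral_blocks_starts)
  have "l < length ss" "j < length ss" using assms ss(1) by auto
  then have less: "ss ! j < ss ! l" and "ss ! l \<in> set ss"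
    using assms(1) ss(2) by (auto simp: sorted_wrt_iff_nth_less)
  then have "block_start k i xs (ss ! l)"
    unfolding ss(3) by simp
  with less show ?thesis
    by (rule block_from_less) (use assms ss(1) in auto)
qed

lemma non_neutral_column_in_block:
  assumes "t < length xs" "cpar t \<noteq> Neutral"
  obtains j where "j < length blocks" "t \<in> nncols (blocks ! j)"
proof -
  obtain s where s: "block_start k i xs s" "t \<in> block_from k i xs s"
    using ex_block_from[OF assms(1)] by auto
  with assms(2) have t: "t \<in> nncols (block_from k i xs s)"
    by (simp add: non_neutral_columns_def)
  obtain ss where ss: "blocks = map (block_from k i xs) ss"
    "set ss = {s. block_start k i xs s \<and> nncols (block_from k i xs s) \<noteq> {}}"
    by (rule non_neutral_blocks_starts)
  then have "s \<in> set ss" using s t by auto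
  then obtain j where "j < length ss" "ss ! j = s" by (auto simp: in_set_conv_nth)
  with ss t show thesis by (intro that[of j]) auto
qed

lemma non_neutral_columnsD: "t \<in> nncols B \<Longrightarrow> t \<in> B"
  by (simp add: non_neutral_columns_def)

text \<open>The start \<open>s\<close> of the right block lies beyond the anchor of the left one, so
  it is not column 0 and has a nearest non-neutral column \<open>r\<close> of different parity
  before it. The order of the blocks and their uniform parity leave only the left block for
  \<open>r\<close>.\<close>

lemma block_parity_Suc:
  assumes "Suc j < length blocks"
  shows "bpar (blocks ! Suc j) = opposite (bpar (blocks ! j))"
proof -
  obtain s where s: "blocks ! Suc j = block_from k i xs s" "block_start k i xs s"
    using assms by (rule non_neutral_blocks_nth)
  have s_in: "s \<in> blocks ! Suc j"
    using s by (auto simp: block_from_def block_start_def)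
  have j: "j < length blocks" using assms by simp
  let ?a = "anchor k i xs (blocks ! j)"
  have a: "?a \<in> nncols (blocks ! j)" by (rule anchor_in_block[OF j])
  have "?a < s"
    using non_neutral_blocks_less[OF lessI assms non_neutral_columnsD[OF a] s_in] .
  then obtain r where r: "cpar s \<noteq> Neutral" "r < s" "cpar r \<noteq> Neutral"
    "\<forall>q. r < q \<and> q < s \<longrightarrow> cpar q = Neutral" "cpar r \<noteq> cpar s"
    using s(2) by (auto simp: block_start_def)
  have "r < length xs" using r(2) s(2) by (auto simp: block_start_def)
  then obtain l where l: "l < length blocks" "r \<in> nncols (blocks ! l)"
    using non_neutral_column_in_block r(3) by metis
  have "?a \<le> r"
    using r(4) \<open>?a < s\<close> a by (auto simp: non_neutral_columns_def not_less[symmetric])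
  have "l = j"
  proof (rule linorder_cases[of l j])
    assume "l < j"
    then have "r < ?a"
      using non_neutral_blocks_less j non_neutral_columnsD[OF l(2)] non_neutral_columnsD[OF a] by blast
    with \<open>?a \<le> r\<close> show ?thesis by simp
  next
    assume "j < l"
    then consider "l = Suc j" | "Suc j < l" by linarith
    then show ?thesis
    proof cases
      case 1
      then have "cpar r = cpar s"
        using block_column_parity[OF assms, of r] block_column_parity[OF assms, of s] l(2) s_in r(1)
        by (simp add: non_neutral_columns_def)
      with r(5) show ?thesis by simp
    next
      case 2
      then have "s < r"
        using non_neutral_blocks_less l(1) s_in non_neutral_columnsD[OF l(2)] by blast
      with r(2) show ?thesis by simp
    qed
  qed
  then have "cpar r = bpar (blocks ! j)"
    using block_column_parity[OF l] by simp
  moreover have "cpar s = bpar (blocks ! Suc j)"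
    using block_column_parity[OF assms] s_in r(1) by (simp add: non_neutral_columns_def)
  ultimately show ?thesis
    using r(1,3,5) by (cases "bpar (blocks ! j)"; cases "bpar (blocks ! Suc j)") auto
qed

section \<open>Alternating subsequences read off from the blocks\<close>

lemma block_column_less_length:
  assumes "j < length blocks" "t \<in> nncols (blocks ! j)"
  shows "t < length xs"
proof -
  obtain s where "blocks ! j = block_from k i xs s"
    using assms(1) by (rule non_neutral_blocks_nth)
  then show ?thesis using assms(2) by (simp add: non_neutral_columns_def block_from_def)
qed

text \<open>Neighbours in an alternation have opposite parities and lie in different blocks, so the
  block index grows at each step. Conversely, the anchors of the preceding blocks alternate. The
  bound \<open>T\<close> is there because \<open>alternates\<close> recurses on prefixes.\<close>

lemma alternates_take_blocks:
  assumes "p \<noteq> Neutral"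
  shows "alternates (Suc m) p (take T (map (column_parity k i) xs)) \<longleftrightarrow>
    (\<exists>j t. m \<le> j \<and> j < length blocks \<and> bpar (blocks ! j) = p \<and> t < T \<and> t \<in> nncols (blocks ! j))"
  using assms
proof (induction m arbitrary: p T)
  have step: "alternates (Suc m) p (take T (map (column_parity k i) xs)) \<longleftrightarrow>
      (\<exists>t<T. t < length xs \<and> cpar t = p \<and> alternates m (opposite p) (take t (map (column_parity k i) xs)))"
    for m p T
    by (auto simp: min_absorb1)
  {
    case 0
    show ?case
      unfolding step alternates.simps(1)
    proof (intro iffI; elim exE conjE)
      fix t assume t: "t < T" "t < length xs" "cpar t = p"
      then obtain j where j: "j < length blocks" "t \<in> nncols (blocks ! j)"
        using non_neutral_column_in_block[of t thesis] 0 by blast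
      with t block_column_parity[OF j] show "\<exists>j t. 0 \<le> j \<and> j < length blocks \<and>
          bpar (blocks ! j) = p \<and> t < T \<and> t \<in> nncols (blocks ! j)"
        by auto
    next
      fix j t assume "j < length blocks" "bpar (blocks ! j) = p" "t < T" "t \<in> nncols (blocks ! j)"
      then show "\<exists>t<T. t < length xs \<and> cpar t = p \<and> True"
        using block_column_less_length block_column_parity by blast
    qed
  next
    case (Suc m)
    have IH: "alternates (Suc m) (opposite p) (take t (map (column_parity k i) xs)) \<longleftrightarrow>
        (\<exists>j u. m \<le> j \<and> j < length blocks \<and> bpar (blocks ! j) = opposite p \<and> u < t \<and> u \<in> nncols (blocks ! j))"
      for t
      using Suc.prems by (intro Suc.IH) (cases p; simp)
    show ?case
      unfolding step[of "Suc m"] IH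
    proof (intro iffI; elim exE conjE)
      fix t j u assume t: "t < T" "t < length xs" "cpar t = p" and
        u: "m \<le> j" "j < length blocks" "bpar (blocks ! j) = opposite p" "u < t" "u \<in> nncols (blocks ! j)"
      obtain l where l: "l < length blocks" "t \<in> nncols (blocks ! l)"
        using t(2,3) Suc.prems by (metis non_neutral_column_in_block)
      have p: "bpar (blocks ! l) = p"
        using block_column_parity[OF l] t(3) by simp
      have "\<not> l < j"
        using non_neutral_blocks_less[of l j t u] non_neutral_columnsD[OF l(2)] non_neutral_columnsD[OF u(5)] u(2,4) by auto
      moreover have "l \<noteq> j"
        using p u(3) Suc.prems by (cases p) auto
      ultimately have "Suc m \<le> l" using u(1) by simp
      then show "\<exists>j t. Suc m \<le> j \<and> j < length blocks \<and> bpar (blocks ! j) = p \<and> t < T \<and> t \<in> nncols (blocks ! j)"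
        using l p t(1) by blast
    next
      fix j t assume j: "Suc m \<le> j" "j < length blocks" "bpar (blocks ! j) = p" "t < T" "t \<in> nncols (blocks ! j)"
      then obtain l where l: "j = Suc l" "m \<le> l" by (cases j) auto
      let ?u = "anchor k i xs (blocks ! l)"
      have u: "?u \<in> nncols (blocks ! l)"
        using j(2) l by (intro anchor_in_block) simp
      have "?u < t"
        using non_neutral_blocks_less[of l j ?u t] j(2,5) l non_neutral_columnsD[OF u] non_neutral_columnsD[OF j(5)] by simp
      moreover have "bpar (blocks ! l) = opposite p"
        using block_parity_Suc[of l] j(2,3) unfolding l(1) by (metis opposite_opposite)
      ultimately show "\<exists>t<T. t < length xs \<and> cpar t = p \<and>
          (\<exists>j u. m \<le> j \<and> j < length blocks \<and> bpar (blocks ! j) = opposite p \<and> u < t \<and> u \<in> nncols (blocks ! j))"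
        using u l j(2,4) block_column_less_length[OF j(2,5)] block_column_parity[OF j(2,5)] j(3)
          Suc_lessD by blast
    qed
  }
qed

text \<open>If some block from index \<open>m\<close> on has parity \<open>p\<close>, then by
  alternation one of the first two does. The two disjuncts become the overlinings with one and with
  two overlined entries.\<close>

lemma alternates_blocks:
  assumes "p \<noteq> Neutral"
  shows "alternates (Suc m) p (map (column_parity k i) xs) \<longleftrightarrow>
    m < length blocks \<and> bpar (blocks ! m) = p \<or> Suc m < length blocks \<and> bpar (blocks ! Suc m) = p"
proof -
  have "take (length xs) (map (column_parity k i) xs) = map (column_parity k i) xs"
    by simp
  then have "alternates (Suc m) p (map (column_parity k i) xs) \<longleftrightarrow>
      (\<exists>j t. m \<le> j \<and> j < length blocks \<and> bpar (blocks ! j) = p \<and> t < length xs \<and> t \<in> nncols (blocks ! j))"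
    using alternates_take_blocks[OF assms, of m "length xs"] by (simp only:)
  also have "\<dots> \<longleftrightarrow> (\<exists>j\<ge>m. j < length blocks \<and> bpar (blocks ! j) = p)"
  proof (intro iffI; elim exE conjE)
    fix j assume j: "m \<le> j" "j < length blocks" "bpar (blocks ! j) = p"
    then show "\<exists>j t. m \<le> j \<and> j < length blocks \<and> bpar (blocks ! j) = p \<and> t < length xs \<and> t \<in> nncols (blocks ! j)"
      using anchor_in_block[OF j(2)] block_column_less_length[OF j(2)] by blast
  qed blast
  also have "\<dots> \<longleftrightarrow> m < length blocks \<and> bpar (blocks ! m) = p \<or>
      Suc m < length blocks \<and> bpar (blocks ! Suc m) = p" (is "?L \<longleftrightarrow> ?R")
  proof
    assume ?L
    then obtain j where j: "m \<le> j" "j < length blocks" "bpar (blocks ! j) = p" by blast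
    show ?R
    proof (cases "j = m \<or> bpar (blocks ! m) = p")
      case False
      then have "Suc m < length blocks" "bpar (blocks ! m) \<noteq> p" using j by auto
      moreover have "bpar (blocks ! m) \<noteq> Neutral" using j by (intro block_parity_not_Neutral) simp
      ultimately show ?thesis
        using block_parity_Suc[of m] assms by (cases p; cases "bpar (blocks ! m)") auto
    qed (use j in auto)
  next
    assume ?R
    then show ?L
      using le_refl[of m] le_SucI[of m m] by blast
  qed
  finally show ?thesis .
qed

section \<open>Overlinings as sets of marked blocks\<close>

lemma anchor_in_block_iff:
  assumes "j < length blocks" "l < length blocks"
  shows "anchor k i xs (blocks ! j) \<in> blocks ! l \<longleftrightarrow> j = l"
proof -
  have "anchor k i xs (blocks ! j) \<in> blocks ! j"
    by (rule non_neutral_columnsD[OF anchor_in_block[OF assms(1)]])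
  then show ?thesis
    using non_neutral_blocks_less[of j l] non_neutral_blocks_less[of l j] assms
    by (metis less_irrefl linorder_neqE_nat)
qed

text \<open>Since blocks in the list are never neutral and neighbours have opposite parities, the
  admissible overlinings amount to marking no block, one block, or two consecutive blocks.\<close>

lemma singular_overpartition_marked_iff:
  "singular_overpartition k i n (xs, T, U) \<longleftrightarrow> frobenius_symbol n xs \<and>
     ((xs, T, U) = marked_symbol k i xs {} \<or>
      (\<exists>j < length blocks. (xs, T, U) = marked_symbol k i xs {j}) \<or>
      (\<exists>j. Suc j < length blocks \<and> (xs, T, U) = marked_symbol k i xs {j, Suc j}))"
proof -
  have none: "(xs, T, U) = marked_symbol k i xs {} \<longleftrightarrow> T = {} \<and> U = {}"
    by (simp add: marked_symbol_def Let_def)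
  have one: "(xs, T, U) = marked_symbol k i xs {j} \<longleftrightarrow>
      positive_block k i xs (blocks ! j) \<and> T = {anchor k i xs (blocks ! j)} \<and> U = {} \<or>
      negative_block k i xs (blocks ! j) \<and> T = {} \<and> U = {anchor k i xs (blocks ! j)}"
    if "j < length blocks" for j
  proof -
    have pos: "{l \<in> {j}. bpar (blocks ! l) = Positive} = (if bpar (blocks ! j) = Positive then {j} else {})"
      and neg: "{l \<in> {j}. bpar (blocks ! l) = Negative} = (if bpar (blocks ! j) = Negative then {j} else {})"
      by auto
    show ?thesis
      unfolding marked_symbol_def Let_def pos neg
      using that block_parity_not_Neutral[OF that]
      by (cases "bpar (blocks ! j)") (simp_all add: positive_block_iff negative_block_iff)
  qed
  have two: "(xs, T, U) = marked_symbol k i xs {j, Suc j} \<longleftrightarrow>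
      positive_block k i xs (blocks ! j) \<and> negative_block k i xs (blocks ! Suc j) \<and>
        T = {anchor k i xs (blocks ! j)} \<and> U = {anchor k i xs (blocks ! Suc j)} \<or>
      negative_block k i xs (blocks ! j) \<and> positive_block k i xs (blocks ! Suc j) \<and>
        T = {anchor k i xs (blocks ! Suc j)} \<and> U = {anchor k i xs (blocks ! j)}"
    if j: "Suc j < length blocks" for j
  proof -
    have pos: "{l \<in> {j, Suc j}. bpar (blocks ! l) = Positive} =
        (if bpar (blocks ! j) = Positive then {j} else {}) \<union>
        (if bpar (blocks ! Suc j) = Positive then {Suc j} else {})"
      and neg: "{l \<in> {j, Suc j}. bpar (blocks ! l) = Negative} =
        (if bpar (blocks ! j) = Negative then {j} else {}) \<union>
        (if bpar (blocks ! Suc j) = Negative then {Suc j} else {})"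
      by auto
    show ?thesis
      unfolding marked_symbol_def Let_def pos neg
      using j block_parity_not_Neutral[of j] block_parity_Suc[OF j]
      by (cases "bpar (blocks ! j)") (simp_all add: positive_block_iff negative_block_iff)
  qed
  show ?thesis
    unfolding singular_overpartition_def Let_def split_conv
    by (simp only: none one two ex_disj_distrib conj_disj_distribL disj_assoc cong: conj_cong)
qed

text \<open>The marked set can be read back from the overlined entries: distinct blocks have
  distinct anchors, and an anchor lies in no other block.\<close>

lemma dotted_blocks_marked:
  assumes "J \<subseteq> {..<length blocks}"
  shows "dotted_blocks k i (marked_symbol k i xs J) =
    (if card J = 0 then {} else if card J = 1 then {0..Max J} else {1..Max J})"
proof -
  let ?a = "\<lambda>j. anchor k i xs (blocks ! j)"
  let ?P = "{j \<in> J. bpar (blocks ! j) = Positive}" and ?N = "{j \<in> J. bpar (blocks ! j) = Negative}"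
  have fin: "finite J"
    using assms finite_lessThan by (rule finite_subset)
  have J_less: "j < length blocks" if "j \<in> J" for j
    using assms that by blast
  have J: "J = ?P \<union> ?N"
  proof (intro equalityI subsetI)
    fix j assume "j \<in> J"
    with block_parity_not_Neutral[OF J_less] show "j \<in> ?P \<union> ?N"
      by (cases "bpar (blocks ! j)") auto
  qed auto
  have "inj_on ?a J"
  proof (rule inj_onI)
    fix j l assume "j \<in> J" "l \<in> J" "?a j = ?a l"
    then show "j = l"
      using anchor_in_block_iff[OF J_less J_less, of j l] anchor_in_block_iff[OF J_less J_less, of l l]
      by metis
  qed
  then have "card (?a ` ?P) = card ?P" "card (?a ` ?N) = card ?N"
    by (auto intro!: card_image elim: inj_on_subset)
  moreover have "card J = card ?P + card ?N"
    using fin by (subst J, intro card_Un_disjoint) auto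
  ultimately have card: "card (?a ` ?P) + card (?a ` ?N) = card J" by simp
  have "?a ` ?P \<union> ?a ` ?N = ?a ` J"
    using J by blast
  moreover have "{l. l < length blocks \<and> ?a ` J \<inter> blocks ! l \<noteq> {}} = J"
  proof (intro equalityI subsetI)
    fix l assume "l \<in> J"
    then show "l \<in> {l. l < length blocks \<and> ?a ` J \<inter> blocks ! l \<noteq> {}}"
      using J_less[of l] anchor_in_block_iff[of l l] by blast
  next
    fix l assume "l \<in> {l. l < length blocks \<and> ?a ` J \<inter> blocks ! l \<noteq> {}}"
    then obtain j where "j \<in> J" "l < length blocks" "?a j \<in> blocks ! l" by blast
    then show "l \<in> J"
      using anchor_in_block_iff[OF J_less] by blast
  qed
  ultimately show ?thesis
    unfolding dotted_blocks_def marked_symbol_def Let_def split_conv card by (simp only:)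
qed

lemma dotted_marked_one:
  assumes "j < length blocks"
  shows "card (dotted_blocks k i (marked_symbol k i xs {j})) = Suc j"
    and "last_dotted_block k i (marked_symbol k i xs {j}) = blocks ! j"
proof -
  have dotted: "dotted_blocks k i (marked_symbol k i xs {j}) = {0..j}"
    using assms by (subst dotted_blocks_marked) auto
  then show "card (dotted_blocks k i (marked_symbol k i xs {j})) = Suc j"
    by simp
  have "Max {0..j} = j"
    by (intro Max_eqI) auto
  with dotted show "last_dotted_block k i (marked_symbol k i xs {j}) = blocks ! j"
    by (simp add: last_dotted_block_def)
qed

text \<open>The dots skip list index 0 but reach one block further than those of \<open>{j}\<close>:
  their number is the same, while the last dotted block has the opposite parity.\<close>

lemma dotted_marked_two:
  assumes "Suc j < length blocks"
  shows "card (dotted_blocks k i (marked_symbol k i xs {j, Suc j})) = Suc j"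
    and "last_dotted_block k i (marked_symbol k i xs {j, Suc j}) = blocks ! Suc j"
proof -
  have dotted: "dotted_blocks k i (marked_symbol k i xs {j, Suc j}) = {1..Suc j}"
    using assms by (subst dotted_blocks_marked) auto
  then show "card (dotted_blocks k i (marked_symbol k i xs {j, Suc j})) = Suc j"
    by simp
  have "Max {1..Suc j} = Suc j"
    by (intro Max_eqI) auto
  with dotted show "last_dotted_block k i (marked_symbol k i xs {j, Suc j}) = blocks ! Suc j"
    by (simp add: last_dotted_block_def)
qed

text \<open>With \<open>Suc m\<close> dotted blocks the marked set is \<open>{m}\<close> or
  \<open>{m, Suc m}\<close>, and the last dotted block has index \<open>m\<close> or
  \<open>Suc m\<close>. These blocks have opposite parities, so \<open>p\<close> selects exactly one
  of the two overlinings.\<close>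

lemma singular_overpartition_last_parity_iff:
  assumes "p \<noteq> Neutral"
  shows "singular_overpartition k i n (xs, T, U) \<and> card (dotted_blocks k i (xs, T, U)) = Suc m \<and>
      bpar (last_dotted_block k i (xs, T, U)) = p \<longleftrightarrow>
    frobenius_symbol n xs \<and> alternates (Suc m) p (map (column_parity k i) xs) \<and>
      (xs, T, U) = marked_symbol k i xs (if bpar (blocks ! m) = p then {m} else {m, Suc m})"
  (is "?L \<longleftrightarrow> ?R")
proof
  assume L: ?L
  \<comment> \<open>This excludes the symbol without overlined entries, as \<open>Suc m\<close> is
    positive.\<close>
  have "dotted_blocks k i (marked_symbol k i xs {}) = {}"
    by (subst dotted_blocks_marked) auto
  with L consider (one) j where "j < length blocks" "(xs, T, U) = marked_symbol k i xs {j}"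
    | (two) j where "Suc j < length blocks" "(xs, T, U) = marked_symbol k i xs {j, Suc j}"
    unfolding singular_overpartition_marked_iff by force
  then show ?R
  proof cases
    case one
    with L have "j = m" "bpar (blocks ! m) = p"
      by (auto simp: dotted_marked_one)
    with one L show ?thesis
      unfolding alternates_blocks[OF assms] singular_overpartition_marked_iff by simp
  next
    case two
    with L have "j = m" "bpar (blocks ! Suc m) = p"
      by (auto simp: dotted_marked_two)
    moreover have "bpar (blocks ! m) \<noteq> p"
      using block_parity_Suc[of m] two(1) calculation assms by (cases p) auto
    ultimately show ?thesis
      using two L unfolding alternates_blocks[OF assms] singular_overpartition_marked_iff by simp
  qed
next
  assume R: ?R
  show ?L
  proof (cases "bpar (blocks ! m) = p")
    case True
    \<comment> \<open>Both disjuncts of \<open>alternates_blocks\<close> put \<open>m\<close> in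
      range, so \<open>blocks ! m\<close> is a genuine block.\<close>
    with R have "m < length blocks" "(xs, T, U) = marked_symbol k i xs {m}"
      unfolding alternates_blocks[OF assms] by auto
    note m = this
    have "singular_overpartition k i n (xs, T, U)"
      unfolding singular_overpartition_marked_iff using R m by blast
    then show ?thesis
      using dotted_marked_one[OF m(1)] True unfolding m(2) by simp
  next
    case False
    with R have m: "Suc m < length blocks" "(xs, T, U) = marked_symbol k i xs {m, Suc m}"
      "bpar (blocks ! Suc m) = p"
      unfolding alternates_blocks[OF assms] by auto
    have "singular_overpartition k i n (xs, T, U)"
      unfolding singular_overpartition_marked_iff using R m by blast
    then show ?thesis
      using dotted_marked_two[OF m(1)] m(3) unfolding m(2) by simp
  qed
qed

end

section \<open>Counting the singular overpartitions\<close>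

lemma card_singular_overpartitions:
  assumes "p \<noteq> Neutral"
  shows "card {\<omega>. singular_overpartition k i n \<omega> \<and> card (dotted_blocks k i \<omega>) = Suc m \<and>
      block_parity k i (fst \<omega>) (last_dotted_block k i \<omega>) = p} =
    card {xs. frobenius_symbol n xs \<and> alternates (Suc m) p (map (column_parity k i) xs)}"
proof -
  let ?f = "\<lambda>xs. marked_symbol k i xs
    (if block_parity k i xs (non_neutral_blocks k i xs ! m) = p then {m} else {m, Suc m})"
  let ?S = "{xs. frobenius_symbol n xs \<and> alternates (Suc m) p (map (column_parity k i) xs)}"
  have "{\<omega>. singular_overpartition k i n \<omega> \<and> card (dotted_blocks k i \<omega>) = Suc m \<and>
      block_parity k i (fst \<omega>) (last_dotted_block k i \<omega>) = p} = ?f ` ?S"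
  proof (rule set_eqI)
    fix \<omega> :: overlined_symbol
    obtain xs T U where \<omega>: "\<omega> = (xs, T, U)" by (metis surj_pair)
    have "\<omega> \<in> ?f ` ?S \<longleftrightarrow> xs \<in> ?S \<and> (xs, T, U) = ?f xs"
    proof
      assume "\<omega> \<in> ?f ` ?S"
      then obtain ys where ys: "ys \<in> ?S" "\<omega> = ?f ys" by blast
      then have "ys = xs" using fst_marked_symbol[of k i ys] \<omega> by (metis fst_conv)
      with ys \<omega> show "xs \<in> ?S \<and> (xs, T, U) = ?f xs" by simp
    qed (use \<omega> in blast)
    then show "\<omega> \<in> {\<omega>. singular_overpartition k i n \<omega> \<and> card (dotted_blocks k i \<omega>) = Suc m \<and>
        block_parity k i (fst \<omega>) (last_dotted_block k i \<omega>) = p} \<longleftrightarrow> \<omega> \<in> ?f ` ?S"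
      using singular_overpartition_last_parity_iff[OF assms, of k i n xs T U m]
      unfolding \<omega> mem_Collect_eq fst_conv by blast
  qed
  \<comment> \<open>Marking leaves the underlying symbol in the first component, so
    \<open>fst\<close> undoes it.\<close>
  moreover have "inj_on ?f ?S"
    by (rule inj_on_inverseI[of _ fst]) (rule fst_marked_symbol)
  ultimately show ?thesis
    by (simp only: card_image)
qed

text \<open>Supplies the membership in the block list under which \<open>negative_block_iff\<close>
  and \<open>positive_block_iff\<close> translate block signs into \<open>block_parity\<close>. A
  positive number of dotted blocks rules out the empty marking.\<close>

lemma last_dotted_block_in_blocks:
  assumes "singular_overpartition k i n \<omega>" "card (dotted_blocks k i \<omega>) > 0"
  obtains j where "j < length (non_neutral_blocks k i (fst \<omega>))"
    "last_dotted_block k i \<omega> = non_neutral_blocks k i (fst \<omega>) ! j"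
proof -
  obtain xs T U where \<omega>: "\<omega> = (xs, T, U)" by (metis surj_pair)
  have "dotted_blocks k i (marked_symbol k i xs {}) = {}"
    by (subst dotted_blocks_marked) auto
  with assms consider (one) j where "j < length (non_neutral_blocks k i xs)" "\<omega> = marked_symbol k i xs {j}"
    | (two) j where "Suc j < length (non_neutral_blocks k i xs)" "\<omega> = marked_symbol k i xs {j, Suc j}"
    unfolding \<omega> singular_overpartition_marked_iff by force
  then show thesis
    by cases (auto simp: dotted_marked_one dotted_marked_two intro: that)
qed

theorem theorem3p1:
  fixes k i :: int and m n :: nat
  assumes "k \<ge> 3" and "1 \<le> i" and "i \<le> k - 1" and "m > 0"
  shows "card {\<omega>. singular_overpartition k i n \<omega> \<and> card (dotted_blocks k i \<omega>) = m \<and>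
                  negative_block k i (fst \<omega>) (last_dotted_block k i \<omega>)}
           = partition_count (int n - k * int (m choose 2) - i * int m) \<and>
         card {\<omega>. singular_overpartition k i n \<omega> \<and> card (dotted_blocks k i \<omega>) = m \<and>
                  positive_block k i (fst \<omega>) (last_dotted_block k i \<omega>)}
           = partition_count (int n - k * int ((m + 1) choose 2) + i * int m)"
proof -
  obtain l where m: "m = Suc l"
    using assms(4) by (cases m) auto
  have last: "negative_block k i (fst \<omega>) (last_dotted_block k i \<omega>) \<longleftrightarrow>
        block_parity k i (fst \<omega>) (last_dotted_block k i \<omega>) = Negative"
      "positive_block k i (fst \<omega>) (last_dotted_block k i \<omega>) \<longleftrightarrow>
        block_parity k i (fst \<omega>) (last_dotted_block k i \<omega>) = Positive"
    if singular: "singular_overpartition k i n \<omega>" and dotted: "card (dotted_blocks k i \<omega>) = m" for \<omega>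
  proof -
    obtain j where "j < length (non_neutral_blocks k i (fst \<omega>))"
      "last_dotted_block k i \<omega> = non_neutral_blocks k i (fst \<omega>) ! j"
      using last_dotted_block_in_blocks[OF singular] dotted assms(4) by auto
    then show "negative_block k i (fst \<omega>) (last_dotted_block k i \<omega>) \<longleftrightarrow>
          block_parity k i (fst \<omega>) (last_dotted_block k i \<omega>) = Negative"
        "positive_block k i (fst \<omega>) (last_dotted_block k i \<omega>) \<longleftrightarrow>
          block_parity k i (fst \<omega>) (last_dotted_block k i \<omega>) = Positive"
      by (simp_all add: negative_block_iff positive_block_iff)
  qed
  have "card {\<omega>. singular_overpartition k i n \<omega> \<and> card (dotted_blocks k i \<omega>) = m \<and>
                 negative_block k i (fst \<omega>) (last_dotted_block k i \<omega>)} =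
        card {\<omega>. singular_overpartition k i n \<omega> \<and> card (dotted_blocks k i \<omega>) = m \<and>
                 block_parity k i (fst \<omega>) (last_dotted_block k i \<omega>) = Negative}"
    using last(1) by (intro arg_cong[of _ _ card] Collect_cong) blast
  also have "\<dots> = partition_count (int n - k * int (m choose 2) - i * int m)"
    unfolding m
    using card_singular_overpartitions[of Negative k i n l] card_frobenius_Negative[OF assms(1,2), of n "Suc l"]
    by (simp only: parity.distinct not_False_eq_True simp_thms)
  finally have negative: "card {\<omega>. singular_overpartition k i n \<omega> \<and> card (dotted_blocks k i \<omega>) = m \<and>
      negative_block k i (fst \<omega>) (last_dotted_block k i \<omega>)} =
    partition_count (int n - k * int (m choose 2) - i * int m)" .
  have "card {\<omega>. singular_overpartition k i n \<omega> \<and> card (dotted_blocks k i \<omega>) = m \<and>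
                 positive_block k i (fst \<omega>) (last_dotted_block k i \<omega>)} =
        card {\<omega>. singular_overpartition k i n \<omega> \<and> card (dotted_blocks k i \<omega>) = m \<and>
                 block_parity k i (fst \<omega>) (last_dotted_block k i \<omega>) = Positive}"
    using last(2) by (intro arg_cong[of _ _ card] Collect_cong) blast
  also have "\<dots> = partition_count (int n - k * int ((m + 1) choose 2) + i * int m)"
    unfolding m
    using card_singular_overpartitions[of Positive k i n l] card_frobenius_Positive[OF assms(1,3), of n "Suc l"]
    by (simp only: parity.distinct not_False_eq_True simp_thms)
  finally show ?thesis
    using negative by (intro conjI)
qed

end
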